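(* Let $(\Omega,\mathcal{H},\mathbb{E})$ be a sub-linear expectation space satisfying condition (CC) with the family $\mathcal{P}$. Let $\{X_n;n\geq 1\}$ be a sequence of independent random variables in it, and let $\{a_n\}$ be real numbers with $1\leq a_n\nearrow\infty$ and $\sum_{n=1}^{\infty}\mathbb{E}[X_n^2]/a_n^2<\infty$. Denote $S_n=\sum_{i=1}^nX_i$. Then: (i) there exists $P\in\mathcal{P}$ such that $$P\left(\limsup_{n\rightarrow\infty}\frac{S_n-\mathbb{E}[S_n]}{a_n}=0\ \text{ and }\ \liminf_{n\rightarrow\infty}\frac{S_n-\hat{\mathcal{E}}[S_n]}{a_n}=0\right)=1;$$ (ii) for any sequence of real numbers $\{\mu_n\}$ with $\hat{\mathcal{E}}[X_n]\leq\mu_n\leq\mathbb{E}[X_n]$ for all $n$, there exists $P\in\mathcal{P}$ such that $$P\left(\lim_{n\rightarrow\infty}\frac{\sum_{i=1}^n(X_i-\mu_i)}{a_n}=0\right)=1.$$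
   Context: A sub-linear expectation space $(\Omega,\mathcal{H},\mathbb{E})$: $(\Omega,\mathcal{F})$ is a measurable space, $\mathcal{H}$ is a linear space of real functions on $\Omega$ closed under composition with locally Lipschitz functions of polynomial growth $|\varphi(x)-\varphi(y)|\le C(1+|x|^m+|y|^m)|x-y|$; $\mathbb{E}:\mathcal{H}\to[-\infty,\infty]$ is monotone, constant preserving, sub-additive and positively homogeneous; $\hat{\mathcal{E}}[X]=-\mathbb{E}[-X]$. Independence: $Y$ is independent of $X$ if $\mathbb{E}[\varphi(X,Y)]=\mathbb{E}\big[\mathbb{E}[\varphi(x,Y)]|_{x=X}\big]$ for every bounded Lipschitz $\varphi$; a sequence is independent if $X_{i+1}$ is independent of $(X_1,\dots,X_i)$ for each $i$. Condition (CC): $\mathbb{E}[X]=\sup_{P\in\mathcal{P}}P[X]$ for all bounded $X\in\mathcal{H}$, where $\mathcal{P}$ is a family of probability measures on $(\Omega,\sigma(\mathcal{H}))$ that is countably-dimensionally weakly compact: for any bounded $Y_1,Y_2,\dots\in\mathcal{H}$ and any sequence $\{P_n\}\subset\mathcal{P}$ there are a subsequence $\{n_k\}$ and $P\in\mathcal{P}$ with $\lim_k P_{n_k}[\varphi(Y_1,\dots,Y_d)]=P[\varphi(Y_1,\dots,Y_d)]$ for all bounded Lipschitz $\varphi$ on $\mathbb{R}^d$, $d\ge1$. *)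

theory Defs
  imports "HOL-Probability.Probability"
begin

text \<open>Vectors in R^d are represented as functions nat => real; only the
coordinates i < d matter.\<close>

definition vnorm :: "nat \<Rightarrow> (nat \<Rightarrow> real) \<Rightarrow> real" where
  "vnorm d x = sqrt (\<Sum>i<d. (x i)^2)"

definition loc_lip_poly :: "nat \<Rightarrow> ((nat \<Rightarrow> real) \<Rightarrow> real) \<Rightarrow> bool" where
  "loc_lip_poly d \<phi> \<longleftrightarrow> (\<exists>C (m::nat). \<forall>x y.
     \<bar>\<phi> x - \<phi> y\<bar> \<le> C * (1 + vnorm d x ^ m + vnorm d y ^ m) * vnorm d (\<lambda>i. x i - y i))"

definition bdd_lip :: "nat \<Rightarrow> ((nat \<Rightarrow> real) \<Rightarrow> real) \<Rightarrow> bool" where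
  "bdd_lip d \<phi> \<longleftrightarrow> bounded (range \<phi>) \<and>
     (\<exists>L. \<forall>x y. \<bar>\<phi> x - \<phi> y\<bar> \<le> L * vnorm d (\<lambda>i. x i - y i))"

definition vecof :: "nat \<Rightarrow> (nat \<Rightarrow> 'a \<Rightarrow> real) \<Rightarrow> 'a \<Rightarrow> (nat \<Rightarrow> real)" where
  "vecof d Xs w = (\<lambda>i. if i < d then Xs i w else 0)"

text \<open>Sub-linear expectation space (Omega = UNIV of type 'a)\<close>
definition sublinear_expectation_space ::
  "('a \<Rightarrow> real) set \<Rightarrow> (('a \<Rightarrow> real) \<Rightarrow> ereal) \<Rightarrow> bool" where
  "sublinear_expectation_space H E \<longleftrightarrow>
     (\<forall>X\<in>H. \<forall>Y\<in>H. (\<lambda>w. X w + Y w) \<in> H) \<and>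
     (\<forall>c. \<forall>X\<in>H. (\<lambda>w. c * X w) \<in> H) \<and>
     (\<forall>c. (\<lambda>_. c) \<in> H) \<and>
     (\<forall>d \<phi> Xs. (\<forall>i<d. Xs i \<in> H) \<and> loc_lip_poly d \<phi> \<longrightarrow> (\<lambda>w. \<phi> (vecof d Xs w)) \<in> H) \<and>
     (\<forall>X\<in>H. \<forall>Y\<in>H. (\<forall>w. X w \<le> Y w) \<longrightarrow> E X \<le> E Y) \<and>
     (\<forall>c. E (\<lambda>_. c) = ereal c) \<and>
     (\<forall>X\<in>H. \<forall>Y\<in>H. E (\<lambda>w. X w + Y w) \<le> E X + E Y) \<and>
     (\<forall>X\<in>H. \<forall>c\<ge>0. E (\<lambda>w. c * X w) = ereal c * E X)"

definition Ehat :: "(('a \<Rightarrow> real) \<Rightarrow> ereal) \<Rightarrow> ('a \<Rightarrow> real) \<Rightarrow> ereal" where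
  "Ehat E X = - E (\<lambda>w. - X w)"

definition indep_of :: "(('a \<Rightarrow> real) \<Rightarrow> ereal) \<Rightarrow> nat \<Rightarrow> (nat \<Rightarrow> 'a \<Rightarrow> real) \<Rightarrow> ('a \<Rightarrow> real) \<Rightarrow> bool" where
  "indep_of E d Xs Y \<longleftrightarrow> (\<forall>\<phi>. bdd_lip (Suc d) \<phi> \<longrightarrow>
     E (\<lambda>w. \<phi> ((vecof d Xs w)(d := Y w))) =
     E (\<lambda>w. real_of_ereal (E (\<lambda>w'. \<phi> ((vecof d Xs w)(d := Y w'))))))"

definition indep_seq :: "(('a \<Rightarrow> real) \<Rightarrow> ereal) \<Rightarrow> (nat \<Rightarrow> 'a \<Rightarrow> real) \<Rightarrow> bool" where
  "indep_seq E X \<longleftrightarrow> (\<forall>i\<ge>1. indep_of E i (\<lambda>j. X (Suc j)) (X (Suc i)))"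

definition sigmaH :: "('a \<Rightarrow> real) set \<Rightarrow> 'a set set" where
  "sigmaH H = sigma_sets UNIV (\<Union>X\<in>H. {X -` B | B. B \<in> sets (borel :: real measure)})"

definition condition_CC ::
  "('a \<Rightarrow> real) set \<Rightarrow> (('a \<Rightarrow> real) \<Rightarrow> ereal) \<Rightarrow> 'a measure set \<Rightarrow> bool" where
  "condition_CC H E Ps \<longleftrightarrow>
     (\<forall>P\<in>Ps. prob_space P \<and> space P = UNIV \<and> sets P = sigmaH H) \<and>
     (\<forall>X\<in>H. bounded (range X) \<longrightarrow> E X = (SUP P\<in>Ps. ereal (integral\<^sup>L P X))) \<and>
     (\<forall>(Y :: nat \<Rightarrow> 'a \<Rightarrow> real) (Pn :: nat \<Rightarrow> 'a measure).
        (\<forall>i. Y i \<in> H \<and> bounded (range (Y i))) \<and> range Pn \<subseteq> Ps \<longrightarrow>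
        (\<exists>r P. strict_mono r \<and> P \<in> Ps \<and>
           (\<forall>d \<phi>. d \<ge> 1 \<and> bdd_lip d \<phi> \<longrightarrow>
              (\<lambda>k. integral\<^sup>L (Pn (r k)) (\<lambda>w. \<phi> (vecof d Y w)))
                \<longlonglongrightarrow> integral\<^sup>L P (\<lambda>w. \<phi> (vecof d Y w)))))"

end

theory Submission
  imports Defs
begin

text \<open>Independence lets the sub-linear expectation dominate every product law whose marginals are
  dominated by the laws of the individual variables, and marginals with prescribed means \<open>\<mu> i\<close>
  are mixtures of the laws under two members of \<open>Ps\<close> attaining the upper and the lower mean. Under
  such a product law the running maxima of the normalised centred sums from time \<open>m j\<close> on have
  expectation at most \<open>2\<^sup>-\<^sup>j\<close> (Hajek--Renyi), so their sum over \<open>j\<close> has a bounded expectation. Hence for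
  each \<open>n\<close> some member of \<open>Ps\<close> gives the truncation of this sum at \<open>n\<close> a bounded expectation; by weak
  compactness one limit does so for all truncations. Finiteness of the sum forces the normalised
  centred sums to converge to 0, which is (ii). For (i), apply this to means that equal the upper
  and the lower mean alternately, on blocks so long that each block outweighs all earlier ones.\<close>

subsection \<open>Functions Lipschitz in finitely many coordinates\<close>

text \<open>Independence is available only for bounded Lipschitz functions, and the representation
  of \<open>E\<close> by \<open>Ps\<close> only for bounded members of \<open>H\<close>. Indicators
  of events, stopping times and the unbounded sums themselves therefore cannot be handed to
  \<open>E\<close>. This is why maxima are capped at 1, why smallness is measured by expectations
  instead of probabilities, and why every statement on an unbounded variable goes through truncation
  at a level \<open>c\<close>, with error at most the second moment divided by \<open>c\<close>.

  Since \<open>E\<close> is a supremum over \<open>Ps\<close>, an upper bound on the functional is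
  sought for one measure only: the product law bounds \<open>E\<close> of minus the functional from
  below, and some member of \<open>Ps\<close> nearly attains that value.

  Domination of product laws has a second use. Part (i) centres at \<open>E\<close> of the sum, and
  sub-additivity gives only one half of its equality with the sum of the upper means; the product
  law with all means extremal gives the other half.\<close>

lemma vnorm_nonneg [simp]: "0 \<le> vnorm d x"
  by (simp add: vnorm_def sum_nonneg)

lemma abs_le_vnorm: "i < d \<Longrightarrow> \<bar>x i\<bar> \<le> vnorm d x"
proof -
  assume "i < d"
  then have "(x i)\<^sup>2 \<le> (\<Sum>j<d. (x j)\<^sup>2)"
    by (intro member_le_sum[of i "{..<d}" "\<lambda>j. (x j)\<^sup>2"]) simp_all
  then have "sqrt ((x i)\<^sup>2) \<le> sqrt (\<Sum>j<d. (x j)\<^sup>2)"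
    by (rule real_sqrt_le_mono)
  then show ?thesis
    by (simp add: vnorm_def)
qed

lemma vnorm_1: "vnorm (Suc 0) x = \<bar>x 0\<bar>"
  by (simp add: vnorm_def)

definition lip :: "nat \<Rightarrow> ((nat \<Rightarrow> real) \<Rightarrow> real) \<Rightarrow> bool" where
  "lip d f \<longleftrightarrow> (\<exists>L. \<forall>x y. \<bar>f x - f y\<bar> \<le> L * vnorm d (\<lambda>i. x i - y i))"

lemma bdd_lip_iff: "bdd_lip d f \<longleftrightarrow> bounded (range f) \<and> lip d f"
  by (simp add: bdd_lip_def lip_def)

lemma lipI: "(\<And>x y. \<bar>f x - f y\<bar> \<le> L * vnorm d (\<lambda>i. x i - y i)) \<Longrightarrow> lip d f"
  by (auto simp: lip_def)

lemma lipE: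
  assumes "lip d f"
  obtains L where "0 \<le> L" "\<And>x y. \<bar>f x - f y\<bar> \<le> L * vnorm d (\<lambda>i. x i - y i)"
proof -
  obtain L where L: "\<And>x y. \<bar>f x - f y\<bar> \<le> L * vnorm d (\<lambda>i. x i - y i)"
    using assms by (auto simp: lip_def)
  have "\<bar>f x - f y\<bar> \<le> \<bar>L\<bar> * vnorm d (\<lambda>i. x i - y i)" for x y
    using L[of x y] mult_right_mono[OF abs_ge_self[of L] vnorm_nonneg[of d "\<lambda>i. x i - y i"]]
    by linarith
  then show ?thesis using that[of "\<bar>L\<bar>"] by simp
qed

lemma lip_const: "lip d (\<lambda>_. c)"
  by (rule lipI[where L = 0]) simp

lemma lip_coord: "i < d \<Longrightarrow> lip d (\<lambda>x. x i)"
  using abs_le_vnorm[of i d] by (intro lipI[where L = 1]) auto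

lemma lip_of_nonexpansive2:
  assumes "lip d f" "lip d g"
    and le: "\<And>x y. \<bar>h x - h y\<bar> \<le> \<bar>f x - f y\<bar> + \<bar>g x - g y\<bar>"
  shows "lip d h"
proof -
  obtain K L where "\<And>x y. \<bar>f x - f y\<bar> \<le> K * vnorm d (\<lambda>i. x i - y i)"
    "\<And>x y. \<bar>g x - g y\<bar> \<le> L * vnorm d (\<lambda>i. x i - y i)"
    using assms(1,2) by (auto simp: lip_def)
  then have "\<bar>h x - h y\<bar> \<le> (K + L) * vnorm d (\<lambda>i. x i - y i)" for x y
    using le[of x y] unfolding distrib_right by (meson add_mono order_trans)
  then show ?thesis by (rule lipI)
qed

lemma lip_add: "lip d f \<Longrightarrow> lip d g \<Longrightarrow> lip d (\<lambda>x. f x + g x)"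
  by (rule lip_of_nonexpansive2[of d f g]) auto

lemma lip_max: "lip d f \<Longrightarrow> lip d g \<Longrightarrow> lip d (\<lambda>x. max (f x) (g x))"
  by (rule lip_of_nonexpansive2[of d f g]) (auto simp: max_def)

lemma lip_min: "lip d f \<Longrightarrow> lip d g \<Longrightarrow> lip d (\<lambda>x. min (f x) (g x))"
  by (rule lip_of_nonexpansive2[of d f g]) (auto simp: min_def)

lemma lip_abs: "lip d f \<Longrightarrow> lip d (\<lambda>x. \<bar>f x\<bar>)"
  by (rule lip_of_nonexpansive2[of d f "\<lambda>_. 0"]) (auto simp: lip_const)

lemma lip_mult_const:
  assumes "lip d f" shows "lip d (\<lambda>x. c * f x)"
proof -
  obtain L where L: "\<And>x y. \<bar>f x - f y\<bar> \<le> L * vnorm d (\<lambda>i. x i - y i)"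
    using assms by (auto simp: lip_def)
  have "\<bar>c * f x - c * f y\<bar> \<le> (\<bar>c\<bar> * L) * vnorm d (\<lambda>i. x i - y i)" for x y
    using mult_left_mono[OF L[of x y] abs_ge_zero[of c]]
    by (simp add: abs_mult right_diff_distrib[symmetric] mult.assoc)
  then show ?thesis by (rule lipI)
qed

lemma lip_sum: "(\<And>i. i \<in> A \<Longrightarrow> lip d (f i)) \<Longrightarrow> lip d (\<lambda>x. \<Sum>i\<in>A. f i x)"
proof (induction A rule: infinite_finite_induct)
  case (insert i A)
  then show ?case by (simp add: lip_add)
qed (simp_all add: lip_const)

text \<open>\<open>vnorm d\<close> is a seminorm that ignores the coordinates from \<open>d\<close>
  on, so a Lipschitz bound in it forces dependence on the first \<open>d\<close> coordinates alone.
  Whatever a path carries beyond them (0 in \<open>vecof\<close>, \<open>undefined\<close> in a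
  finite product) may be exchanged freely.\<close>

lemma lip_cong:
  assumes "lip d f" "\<And>i. i < d \<Longrightarrow> x i = y i"
  shows "f x = f y"
proof -
  obtain L where "\<bar>f x - f y\<bar> \<le> L * vnorm d (\<lambda>i. x i - y i)"
    using assms(1) by (auto simp: lip_def)
  moreover have "vnorm d (\<lambda>i. x i - y i) = 0"
    unfolding vnorm_def using assms(2) by simp
  ultimately show ?thesis by simp
qed

lemma lip_borel_measurable:
  assumes "lip d f" shows "f \<in> borel_measurable borel"
proof (rule borel_measurable_continuous_onI, unfold continuous_on_def, intro ballI)
  fix x
  obtain L where L: "\<And>x y. \<bar>f x - f y\<bar> \<le> L * vnorm d (\<lambda>i. x i - y i)"
    using assms by (auto simp: lip_def)
  have "continuous_on UNIV (\<lambda>y. L * vnorm d (\<lambda>i. y i - x i))"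
    unfolding vnorm_def by (intro continuous_intros) simp
  then have "((\<lambda>y. L * vnorm d (\<lambda>i. y i - x i)) \<longlongrightarrow> L * vnorm d (\<lambda>i. x i - x i)) (at x)"
    unfolding continuous_on_def by blast
  then have "((\<lambda>y. L * vnorm d (\<lambda>i. y i - x i)) \<longlongrightarrow> 0) (at x)"
    by (simp add: vnorm_def)
  then have "((\<lambda>y. f y - f x) \<longlongrightarrow> 0) (at x)"
    by (rule Lim_null_comparison[rotated]) (simp add: L)
  then show "(f \<longlongrightarrow> f x) (at x within UNIV)"
    using LIM_zero_cancel by blast
qed

lemma lip_measurable_PiM_UNIV:
  assumes "lip d f" shows "f \<in> borel_measurable (Pi\<^sub>M UNIV (\<lambda>_. borel))"
  using lip_borel_measurable[OF assms] unfolding measurable_cong_sets[OF sets_PiM_equal_borel refl] .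

lemma lip_measurable_PiM:
  assumes f: "lip d f" and M: "\<And>i. i < d \<Longrightarrow> sets (M i) = sets (borel :: real measure)"
  shows "f \<in> borel_measurable (Pi\<^sub>M {..<d} M)"
proof -
  \<comment> \<open>Points of the finite product are \<open>undefined\<close> outside
    \<open>{..<d}\<close>. Extension by 0 maps them measurably into the full product, where
    \<open>f\<close> is Borel, and \<open>lip_cong\<close> shows that \<open>f\<close> does not
    notice the extension.\<close>
  have "(\<lambda>x i. if i < d then x i else 0) \<in> Pi\<^sub>M {..<d} M \<rightarrow>\<^sub>M Pi\<^sub>M UNIV (\<lambda>_. borel :: real measure)"
  proof (rule measurable_PiM_single')
    fix i :: nat
    show "(\<lambda>x. if i < d then x i else 0) \<in> borel_measurable (Pi\<^sub>M {..<d} M)"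
    proof (cases "i < d")
      case True
      then have "(\<lambda>x. x i) \<in> Pi\<^sub>M {..<d} M \<rightarrow>\<^sub>M M i"
        by simp
      then have "(\<lambda>x. x i) \<in> borel_measurable (Pi\<^sub>M {..<d} M)"
        using measurable_cong_sets[OF refl M[OF True]] by blast
      then show ?thesis using True by simp
    qed simp
  qed simp
  then have "(\<lambda>x. f (\<lambda>i. if i < d then x i else 0)) \<in> borel_measurable (Pi\<^sub>M {..<d} M)"
    by (rule measurable_compose[OF _ lip_measurable_PiM_UNIV[OF f]])
  moreover have "(\<lambda>x. f (\<lambda>i. if i < d then x i else 0)) = f"
    by (intro ext lip_cong[OF f]) simp
  ultimately show ?thesis by simp
qed

lemma lip_fun_upd_measurable:
  assumes f: "lip d f" shows "(\<lambda>y. f (x(n := y))) \<in> borel_measurable borel"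
proof -
  have "(\<lambda>y. x(n := y)) \<in> (borel :: real measure) \<rightarrow>\<^sub>M Pi\<^sub>M UNIV (\<lambda>_. borel)"
    by (rule measurable_PiM_single') auto
  then show ?thesis
    by (rule measurable_compose[OF _ lip_measurable_PiM_UNIV[OF f]])
qed

section \<open>Truncation, centred sums and running maxima\<close>

definition clip :: "real \<Rightarrow> real \<Rightarrow> real" where
  "clip c x = max (- c) (min c x)"

lemma abs_clip_le: "0 \<le> c \<Longrightarrow> \<bar>clip c x\<bar> \<le> c"
  by (auto simp: clip_def)

text \<open>Where truncation acts, the error is at most \<open>\<bar>x\<bar>\<close>, and there
  \<open>c\<close> is below \<open>\<bar>x\<bar>\<close>. A second-moment bound thus makes the error
  O(1/c) uniformly over all measures and under \<open>E\<close>.\<close>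

lemma abs_clip_diff_le: 
  assumes "0 < c" shows "\<bar>clip c x - x\<bar> \<le> x\<^sup>2 / c"
proof (cases "\<bar>x\<bar> \<le> c")
  case True then show ?thesis using assms by (auto simp: clip_def)
next
  case False
  then have "\<bar>clip c x - x\<bar> \<le> \<bar>x\<bar>" using assms by (auto simp: clip_def min_def max_def abs_if)
  also have "\<dots> \<le> x\<^sup>2 / c"
    using False assms mult_right_mono[of c "\<bar>x\<bar>" "\<bar>x\<bar>"]
    by (simp add: field_simps power2_eq_square)
  finally show ?thesis .
qed

lemma lip_clip: "lip d f \<Longrightarrow> lip d (\<lambda>x. clip c (f x))"
  unfolding clip_def by (intro lip_max lip_min lip_const)

text \<open>Paths are indexed from 0: coordinate \<open>i\<close> stands for the paper's $X_{i+1}$.\<close>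

definition centered_sum :: "(nat \<Rightarrow> real) \<Rightarrow> nat \<Rightarrow> (nat \<Rightarrow> real) \<Rightarrow> real" where
  "centered_sum \<mu> n x = (\<Sum>i<n. x i - \<mu> i)"

lemma lip_centered_sum: "n \<le> d \<Longrightarrow> lip d (centered_sum \<mu> n)"
  unfolding centered_sum_def diff_conv_add_uminus
  by (intro lip_sum lip_add lip_const lip_coord) auto

lemma centered_sum_upd: "n \<le> k \<Longrightarrow> centered_sum \<mu> n (x(k := y)) = centered_sum \<mu> n x"
  unfolding centered_sum_def by (intro sum.cong) auto

lemma centered_sum_Suc_upd: "centered_sum \<mu> (Suc n) (x(n := y)) = centered_sum \<mu> n x + (y - \<mu> n)"
  using centered_sum_upd[of n n \<mu> x y] by (simp add: centered_sum_def)

text \<open>The cap at 1 keeps the maximum bounded, and a finite maximum of Lipschitz functions is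
  Lipschitz, so it is an admissible test function for independence. Only times between
  \<open>m\<close> and \<open>n\<close> contribute.\<close>

primrec running_max :: "(nat \<Rightarrow> real) \<Rightarrow> (nat \<Rightarrow> real) \<Rightarrow> nat \<Rightarrow> nat \<Rightarrow> (nat \<Rightarrow> real) \<Rightarrow> real" where
  "running_max \<mu> a m 0 x = 0"
| "running_max \<mu> a m (Suc n) x = max (running_max \<mu> a m n x)
     (if m \<le> Suc n then min 1 (\<bar>centered_sum \<mu> (Suc n) x\<bar> / a (Suc n)) else 0)"

lemma running_max_nonneg: "0 \<le> running_max \<mu> a m n x"
  by (induction n) (auto simp: le_max_iff_disj)

lemma running_max_le_1: "running_max \<mu> a m n x \<le> 1"
  by (induction n) auto

lemma running_max_mono: "n \<le> n' \<Longrightarrow> running_max \<mu> a m n x \<le> running_max \<mu> a m n' x"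
  by (rule lift_Suc_mono_le[of "\<lambda>n. running_max \<mu> a m n x"]) auto

lemma running_max_ge:
  assumes "1 \<le> k" "m \<le> k" "k \<le> n"
  shows "min 1 (\<bar>centered_sum \<mu> k x\<bar> / a k) \<le> running_max \<mu> a m n x"
proof -
  obtain k' where "k = Suc k'" using assms(1) by (cases k) auto
  then have "min 1 (\<bar>centered_sum \<mu> k x\<bar> / a k) \<le> running_max \<mu> a m k x"
    using assms(2) by simp
  then show ?thesis using running_max_mono[OF assms(3)] order_trans by blast
qed

lemma running_max_le:
  assumes "\<And>k. 1 \<le> k \<Longrightarrow> m \<le> k \<Longrightarrow> k \<le> n \<Longrightarrow> \<bar>centered_sum \<mu> k x\<bar> / a k \<le> e" "0 \<le> e"
  shows "running_max \<mu> a m n x \<le> e"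
  using assms(1)
proof (induction n)
  case 0 then show ?case using assms(2) by simp
next
  case (Suc n) then show ?case
    using Suc.prems[of "Suc n"] assms(2) by (auto simp: min_le_iff_disj)
qed

lemma running_max_eq_0: "n < m \<Longrightarrow> running_max \<mu> a m n x = 0"
  by (induction n) auto

lemma lip_running_max: "n \<le> d \<Longrightarrow> lip d (running_max \<mu> a m n)"
proof (induction n)
  case 0
  show ?case by (simp add: lip_const)
next
  case (Suc n)
  have "lip d (\<lambda>x. \<bar>centered_sum \<mu> (Suc n) x\<bar> / a (Suc n))"
    unfolding divide_inverse mult.commute[of _ "inverse _"]
    using Suc.prems by (intro lip_mult_const lip_abs lip_centered_sum)
  then have "lip d (\<lambda>x. if m \<le> Suc n then min 1 (\<bar>centered_sum \<mu> (Suc n) x\<bar> / a (Suc n)) else 0)"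
    by (cases "m \<le> Suc n") (simp_all add: lip_min lip_const)
  then show ?case
    unfolding running_max.simps using Suc by (intro lip_max) simp_all
qed

subsection \<open>A maximal inequality for product laws\<close>

text \<open>The Hajek--Renyi process, frozen at \<open>e\<^sup>2\<close> as soon as the bound \<open>e * a k\<close> is violated. Freezing
  makes the conditional mean grow by at most \<open>s n / (a (Suc n))\<^sup>2\<close> per step, without a stopping time.\<close>

definition stopped ::
  "(nat \<Rightarrow> real) \<Rightarrow> (nat \<Rightarrow> real) \<Rightarrow> real \<Rightarrow> nat \<Rightarrow> nat \<Rightarrow> (nat \<Rightarrow> real) \<Rightarrow> real" where
  "stopped \<mu> a e m n x = (if \<exists>k\<in>{m..n}. e * a k \<le> \<bar>centered_sum \<mu> k x\<bar> then e\<^sup>2 else (centered_sum \<mu> n x / a n)\<^sup>2)"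

locale marginals =
  fixes \<nu> :: "nat \<Rightarrow> real measure" and \<mu> s a :: "nat \<Rightarrow> real"
  assumes prob: "\<And>i. prob_space (\<nu> i)"
    and sets_eq: "\<And>i. sets (\<nu> i) = sets borel"
    and int1: "\<And>i. integrable (\<nu> i) (\<lambda>y. y)"
    and int2: "\<And>i. integrable (\<nu> i) (\<lambda>y. y\<^sup>2)"
    and mean: "\<And>i. integral\<^sup>L (\<nu> i) (\<lambda>y. y) = \<mu> i"
    and second: "\<And>i. integral\<^sup>L (\<nu> i) (\<lambda>y. y\<^sup>2) \<le> s i"
    and a_ge1: "\<And>n. 1 \<le> n \<Longrightarrow> 1 \<le> a n"
    and a_mono: "\<And>n. 1 \<le> n \<Longrightarrow> a n \<le> a (Suc n)"
begin

sublocale PS: product_prob_space \<nu> UNIV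
  by (intro product_prob_spaceI prob)

abbreviation "Q n \<equiv> Pi\<^sub>M {..<n} \<nu>"

lemma Q_prob: "prob_space (Q n)"
  by (intro prob_space_PiM prob)

lemma s_nonneg: "0 \<le> s i"
  by (rule order_trans[OF Bochner_Integration.integral_nonneg second]) simp

lemma centered_sum_meas: "n \<le> d \<Longrightarrow> centered_sum \<mu> n \<in> borel_measurable (Q d)"
  by (intro lip_measurable_PiM lip_centered_sum sets_eq)

lemma stopped_meas: "n \<le> d \<Longrightarrow> stopped \<mu> a e m n \<in> borel_measurable (Q d)"
proof -
  assume "n \<le> d"
  then have [measurable]: "centered_sum \<mu> k \<in> borel_measurable (Q d)" if "k \<le> n" for k
    using centered_sum_meas that by auto
  have [measurable]: "Measurable.pred (Q d) (\<lambda>x. \<exists>k\<in>{m..n}. e * a k \<le> \<bar>centered_sum \<mu> k x\<bar>)"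
    by (intro pred_intros_finite) measurable
  show ?thesis unfolding stopped_def by measurable
qed

text \<open>The increment is centred, so the cross term vanishes and the variance is what remains;
  it is at most the raw second moment, which \<open>s n\<close> bounds.\<close>

lemma one_step:
  "(\<integral>\<^sup>+y. ennreal (((t + (y - \<mu> n)) / A)\<^sup>2) \<partial>\<nu> n) \<le> ennreal ((t / A)\<^sup>2 + s n / A\<^sup>2)"
proof -
  have eq: "((t + (y - \<mu> n)) / A)\<^sup>2 = ((t - \<mu> n)\<^sup>2 + 2 * (t - \<mu> n) * y + y\<^sup>2) / A\<^sup>2" for y
    by (simp add: power_divide power2_eq_square algebra_simps)
  have I: "integrable (\<nu> n) (\<lambda>y. ((t + (y - \<mu> n)) / A)\<^sup>2)"
    unfolding eq using int1 int2 by (intro integrable_divide Bochner_Integration.integrable_add) auto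
  have "integral\<^sup>L (\<nu> n) (\<lambda>y. ((t + (y - \<mu> n)) / A)\<^sup>2)
      = ((t - \<mu> n)\<^sup>2 + 2 * (t - \<mu> n) * \<mu> n + integral\<^sup>L (\<nu> n) (\<lambda>y. y\<^sup>2)) / A\<^sup>2"
    unfolding eq using int1[of n] int2[of n] by (simp add: mean prob_space.prob_space[OF prob])
  also have "\<dots> \<le> (t\<^sup>2 + s n) / A\<^sup>2"
  proof (rule divide_right_mono)
    have "(t - \<mu> n)\<^sup>2 + 2 * (t - \<mu> n) * \<mu> n = t\<^sup>2 - (\<mu> n)\<^sup>2"
      by (simp add: power2_eq_square algebra_simps)
    then show "(t - \<mu> n)\<^sup>2 + 2 * (t - \<mu> n) * \<mu> n + integral\<^sup>L (\<nu> n) (\<lambda>y. y\<^sup>2) \<le> t\<^sup>2 + s n"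
      using second[of n] zero_le_power2[of "\<mu> n"] by linarith
  qed simp
  also have "\<dots> = (t / A)\<^sup>2 + s n / A\<^sup>2"
    by (simp add: power_divide add_divide_distrib)
  finally show ?thesis
    using I by (simp add: nn_integral_eq_integral ennreal_leI)
qed

lemma centered_sum_square_integral:
  "(\<integral>\<^sup>+x. ennreal ((centered_sum \<mu> n x / A)\<^sup>2) \<partial>Q n) \<le> ennreal ((\<Sum>i<n. s i) / A\<^sup>2)"
proof (induction n)
  case 0
  then show ?case by (simp add: centered_sum_def)
next
  case (Suc n)
  interpret Qn: prob_space "Q n" by (rule Q_prob)
  have [measurable]: "centered_sum \<mu> (Suc n) \<in> borel_measurable (Q (Suc n))" "centered_sum \<mu> n \<in> borel_measurable (Q n)"
    by (auto intro: centered_sum_meas)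
  have "(\<integral>\<^sup>+x. ennreal ((centered_sum \<mu> (Suc n) x / A)\<^sup>2) \<partial>Q (Suc n)) =
      (\<integral>\<^sup>+x. \<integral>\<^sup>+y. ennreal ((centered_sum \<mu> (Suc n) (x(n := y)) / A)\<^sup>2) \<partial>\<nu> n \<partial>Q n)"
    unfolding lessThan_Suc
    by (rule PS.product_nn_integral_insert) (auto simp flip: lessThan_Suc)
  also have "\<dots> \<le> (\<integral>\<^sup>+x. ennreal ((centered_sum \<mu> n x / A)\<^sup>2 + s n / A\<^sup>2) \<partial>Q n)"
    unfolding centered_sum_Suc_upd by (intro nn_integral_mono one_step)
  also have "\<dots> = (\<integral>\<^sup>+x. ennreal ((centered_sum \<mu> n x / A)\<^sup>2) \<partial>Q n) + ennreal (s n / A\<^sup>2)"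
    using s_nonneg by (simp add: ennreal_plus nn_integral_add Qn.emeasure_space_1)
  also have "\<dots> \<le> ennreal ((\<Sum>i<n. s i) / A\<^sup>2) + ennreal (s n / A\<^sup>2)"
    by (intro add_mono Suc order_refl)
  also have "\<dots> = ennreal ((\<Sum>i<Suc n. s i) / A\<^sup>2)"
    using s_nonneg by (simp add: add_divide_distrib sum_nonneg flip: ennreal_plus)
  finally show ?case .
qed

text \<open>After a violation the value stays \<open>e\<^sup>2\<close>, because changing coordinate
  \<open>n\<close> leaves the sums up to time \<open>n\<close> alone. Before one, the next value is
  at most the next normalised square, even if the violation occurs right then, since that square is
  then at least \<open>e\<^sup>2\<close>; \<open>one_step\<close> and the growth of \<open>a\<close>
  finish.\<close>

lemma stopped_step:
  assumes "1 \<le> m" "m \<le> n" "0 \<le> e"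
  shows "(\<integral>\<^sup>+y. ennreal (stopped \<mu> a e m (Suc n) (x(n := y))) \<partial>\<nu> n)
    \<le> ennreal (stopped \<mu> a e m n x + s n / (a (Suc n))\<^sup>2)"
proof (cases "\<exists>k\<in>{m..n}. e * a k \<le> \<bar>centered_sum \<mu> k x\<bar>")
  case True
  have "stopped \<mu> a e m (Suc n) (x(n := y)) = e\<^sup>2" for y
    using True unfolding stopped_def by (subst if_P) (auto simp: centered_sum_upd intro!: bexI)
  moreover have "stopped \<mu> a e m n x = e\<^sup>2"
    using True unfolding stopped_def by simp
  ultimately show ?thesis
    using s_nonneg by (simp add: prob_space.emeasure_space_1[OF prob] ennreal_leI)
next
  case False
  have pos: "1 \<le> a n" "1 \<le> a (Suc n)" "a n \<le> a (Suc n)" using a_ge1 a_mono assms by auto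
  have "stopped \<mu> a e m (Suc n) (x(n := y)) \<le> ((centered_sum \<mu> n x + (y - \<mu> n)) / a (Suc n))\<^sup>2" for y
  proof (cases "e * a (Suc n) \<le> \<bar>centered_sum \<mu> n x + (y - \<mu> n)\<bar>")
    case True
    then have "e \<le> \<bar>(centered_sum \<mu> n x + (y - \<mu> n)) / a (Suc n)\<bar>"
      using pos by (simp add: field_simps)
    then have "e\<^sup>2 \<le> ((centered_sum \<mu> n x + (y - \<mu> n)) / a (Suc n))\<^sup>2"
      using assms by (metis abs_of_nonneg power2_abs power_mono)
    then show ?thesis by (simp add: stopped_def centered_sum_Suc_upd)
  next
    case F: False
    have "\<not> (\<exists>k\<in>{m..Suc n}. e * a k \<le> \<bar>centered_sum \<mu> k (x(n := y))\<bar>)"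
    proof
      assume "\<exists>k\<in>{m..Suc n}. e * a k \<le> \<bar>centered_sum \<mu> k (x(n := y))\<bar>"
      then obtain k where k: "k \<in> {m..Suc n}" "e * a k \<le> \<bar>centered_sum \<mu> k (x(n := y))\<bar>" by blast
      show False
      proof (cases "k = Suc n")
        case True then show ?thesis using F k by (simp add: centered_sum_Suc_upd)
      next
        case ne: False
        then have "k \<in> {m..n}" using k by auto
        then show ?thesis using False k by (auto simp: centered_sum_upd)
      qed
    qed
    then show ?thesis unfolding stopped_def by (subst if_not_P) (auto simp: centered_sum_Suc_upd)
  qed
  then have "(\<integral>\<^sup>+y. ennreal (stopped \<mu> a e m (Suc n) (x(n := y))) \<partial>\<nu> n) \<le>
      (\<integral>\<^sup>+y. ennreal (((centered_sum \<mu> n x + (y - \<mu> n)) / a (Suc n))\<^sup>2) \<partial>\<nu> n)"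
    by (intro nn_integral_mono ennreal_leI)
  also have "\<dots> \<le> ennreal ((centered_sum \<mu> n x / a (Suc n))\<^sup>2 + s n / (a (Suc n))\<^sup>2)"
    by (rule one_step)
  also have "\<dots> \<le> ennreal ((centered_sum \<mu> n x / a n)\<^sup>2 + s n / (a (Suc n))\<^sup>2)"
    unfolding power_divide using pos
    by (intro ennreal_leI add_mono divide_left_mono power_mono mult_pos_pos order_refl) auto
  also have "\<dots> = ennreal (stopped \<mu> a e m n x + s n / (a (Suc n))\<^sup>2)"
    using False by (simp add: stopped_def)
  finally show ?thesis .
qed

lemma stopped_integral:
  assumes m: "1 \<le> m" and e: "0 < e" and "m \<le> n"
  shows "(\<integral>\<^sup>+x. ennreal (stopped \<mu> a e m n x) \<partial>Q n)
    \<le> ennreal ((\<Sum>i<m. s i) / (a m)\<^sup>2 + (\<Sum>i=m..<n. s i / (a (Suc i))\<^sup>2))"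
  using \<open>m \<le> n\<close>
proof (induction n rule: dec_induct)
  case base
  have pos: "1 \<le> a m" using a_ge1 m by auto
  have "stopped \<mu> a e m m x \<le> (centered_sum \<mu> m x / a m)\<^sup>2" for x
  proof (cases "e * a m \<le> \<bar>centered_sum \<mu> m x\<bar>")
    case True
    then have "e \<le> \<bar>centered_sum \<mu> m x / a m\<bar>"
      using pos by (simp add: field_simps)
    then have "e\<^sup>2 \<le> (centered_sum \<mu> m x / a m)\<^sup>2"
      using e by (metis abs_of_pos order_less_imp_le power2_abs power_mono)
    then show ?thesis using True by (simp add: stopped_def)
  qed (simp add: stopped_def)
  then have "(\<integral>\<^sup>+x. ennreal (stopped \<mu> a e m m x) \<partial>Q m) \<le> (\<integral>\<^sup>+x. ennreal ((centered_sum \<mu> m x / a m)\<^sup>2) \<partial>Q m)"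
    by (intro nn_integral_mono ennreal_leI)
  also have "\<dots> \<le> ennreal ((\<Sum>i<m. s i) / (a m)\<^sup>2)"
    by (rule centered_sum_square_integral)
  finally show ?case by simp
next
  case (step n)
  interpret Qn: prob_space "Q n" by (rule Q_prob)
  have [measurable]: "stopped \<mu> a e m n \<in> borel_measurable (Q n)"
    "stopped \<mu> a e m (Suc n) \<in> borel_measurable (Q (Suc n))"
    by (auto intro: stopped_meas)
  have nn: "0 \<le> stopped \<mu> a e m n x" for x by (simp add: stopped_def)
  have "(\<integral>\<^sup>+x. ennreal (stopped \<mu> a e m (Suc n) x) \<partial>Q (Suc n)) =
      (\<integral>\<^sup>+x. \<integral>\<^sup>+y. ennreal (stopped \<mu> a e m (Suc n) (x(n := y))) \<partial>\<nu> n \<partial>Q n)"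
    unfolding lessThan_Suc
    by (rule PS.product_nn_integral_insert) (auto simp flip: lessThan_Suc)
  also have "\<dots> \<le> (\<integral>\<^sup>+x. ennreal (stopped \<mu> a e m n x + s n / (a (Suc n))\<^sup>2) \<partial>Q n)"
    using m e step by (intro nn_integral_mono stopped_step) auto
  also have "\<dots> = (\<integral>\<^sup>+x. ennreal (stopped \<mu> a e m n x) \<partial>Q n) + ennreal (s n / (a (Suc n))\<^sup>2)"
    using s_nonneg nn by (simp add: ennreal_plus nn_integral_add Qn.emeasure_space_1)
  also have "\<dots> \<le> ennreal ((\<Sum>i<m. s i) / (a m)\<^sup>2 + (\<Sum>i=m..<n. s i / (a (Suc i))\<^sup>2))
      + ennreal (s n / (a (Suc n))\<^sup>2)"
    by (intro add_mono step.IH order_refl)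
  also have "\<dots> = ennreal ((\<Sum>i<m. s i) / (a m)\<^sup>2 + (\<Sum>i=m..<Suc n. s i / (a (Suc i))\<^sup>2))"
    using s_nonneg step.hyps by (simp add: sum_nonneg add.assoc flip: ennreal_plus)
  finally show ?case .
qed

lemma running_max_meas: "n \<le> d \<Longrightarrow> running_max \<mu> a m n \<in> borel_measurable (Q d)"
  by (intro lip_measurable_PiM lip_running_max sets_eq)

text \<open>Markov's inequality in pointwise form: after a violation the last term equals 1, the cap
  of the maximum; without one the maximum is at most \<open>e\<close>.\<close>

lemma running_max_le_stopped:
  assumes "1 \<le> m" "m \<le> n" "0 < e"
  shows "running_max \<mu> a m n x \<le> e + stopped \<mu> a e m n x / e\<^sup>2"
proof (cases "\<exists>k\<in>{m..n}. e * a k \<le> \<bar>centered_sum \<mu> k x\<bar>")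
  case True
  then have "stopped \<mu> a e m n x / e\<^sup>2 = 1" using assms by (simp add: stopped_def)
  then show ?thesis using running_max_le_1[of \<mu> a m n x] assms by linarith
next
  case False
  have "running_max \<mu> a m n x \<le> e"
  proof (rule running_max_le)
    fix k assume k: "1 \<le> k" "m \<le> k" "k \<le> n"
    then have "\<bar>centered_sum \<mu> k x\<bar> < e * a k" using False by force
    then show "\<bar>centered_sum \<mu> k x\<bar> / a k \<le> e" using a_ge1[OF k(1)] by (simp add: field_simps)
  qed (use assms in auto)
  moreover have "0 \<le> stopped \<mu> a e m n x / e\<^sup>2" by (simp add: stopped_def)
  ultimately show ?thesis by linarith
qed

text \<open>The cube makes the two contributions equal: the Markov term is
  \<open>e ^ 3 / e\<^sup>2 = e\<close>.\<close>

lemma running_max_integral: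
  assumes "1 \<le> m" "m \<le> n" "0 < e"
    and r: "(\<Sum>i<m. s i) / (a m)\<^sup>2 + (\<Sum>i=m..<n. s i / (a (Suc i))\<^sup>2) \<le> e ^ 3"
  shows "integral\<^sup>L (Q n) (running_max \<mu> a m n) \<le> 2 * e"
proof -
  interpret Qn: prob_space "Q n" by (rule Q_prob)
  have [measurable]: "stopped \<mu> a e m n \<in> borel_measurable (Q n)"
    by (auto intro: stopped_meas)
  have "(\<integral>\<^sup>+x. ennreal (running_max \<mu> a m n x) \<partial>Q n) \<le> (\<integral>\<^sup>+x. ennreal e + ennreal (inverse (e\<^sup>2)) * ennreal (stopped \<mu> a e m n x) \<partial>Q n)"
    using running_max_le_stopped[OF assms(1-3)] assms(3)
    by (intro nn_integral_mono)
      (simp add: stopped_def ennreal_leI divide_inverse mult.commute flip: ennreal_plus ennreal_mult)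
  also have "\<dots> = ennreal e + ennreal (inverse (e\<^sup>2)) * (\<integral>\<^sup>+x. ennreal (stopped \<mu> a e m n x) \<partial>Q n)"
    by (simp add: nn_integral_add nn_integral_cmult Qn.emeasure_space_1)
  also have "\<dots> \<le> ennreal e + ennreal (inverse (e\<^sup>2)) * ennreal (e ^ 3)"
    using order_trans[OF stopped_integral[OF assms(1,3,2)] ennreal_leI[OF r]]
    by (intro add_left_mono mult_left_mono) auto
  also have "\<dots> = ennreal (2 * e)"
    using assms(3) by (simp add: power2_eq_square power3_eq_cube field_simps flip: ennreal_plus ennreal_mult)
  finally have "(\<integral>\<^sup>+x. ennreal (running_max \<mu> a m n x) \<partial>Q n) \<le> ennreal (2 * e)" .
  moreover have "integrable (Q n) (running_max \<mu> a m n)"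
    using running_max_nonneg running_max_le_1 running_max_meas
    by (intro Qn.integrable_const_bound[where B = 1]) auto
  ultimately show ?thesis
    using assms(3) running_max_nonneg by (simp add: nn_integral_eq_integral)
qed

end

text \<open>Kronecker's argument: choose \<open>M\<close> with small series tails, then
  \<open>m\<close> beyond \<open>M\<close> with \<open>a m\<close> so large that the terms before
  \<open>M\<close> are negligible. For the terms from \<open>M\<close> to \<open>m\<close>,
  replacing \<open>a m\<close> by the smaller \<open>a (Suc i)\<close> turns them into part of the
  tail.\<close>

lemma kronecker_tail:
  fixes s a :: "nat \<Rightarrow> real"
  assumes s: "\<And>i. 0 \<le> s i" and a1: "\<And>n. 1 \<le> n \<Longrightarrow> 1 \<le> a n"
    and mono: "\<And>n. 1 \<le> n \<Longrightarrow> a n \<le> a (Suc n)"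
    and inf: "filterlim a at_top sequentially"
    and sm: "summable (\<lambda>i. s i / (a (Suc i))\<^sup>2)" and d: "0 < d"
  shows "\<exists>m\<ge>1. \<forall>n\<ge>m. (\<Sum>i<m. s i) / (a m)\<^sup>2 + (\<Sum>i=m..<n. s i / (a (Suc i))\<^sup>2) \<le> d"
proof -
  obtain M where M: "\<And>m n. M \<le> m \<Longrightarrow> (\<Sum>i=m..<n. s i / (a (Suc i))\<^sup>2) < d / 2"
    using sm[unfolded summable_Cauchy] d
    by (metis (no_types, lifting) abs_less_iff half_gt_zero real_norm_def)
  have "((\<lambda>m. (\<Sum>i<M. s i) / (a m)\<^sup>2) \<longlongrightarrow> 0) sequentially"
    by (intro tendsto_divide_0[OF tendsto_const] filterlim_at_top_imp_at_infinity
        filterlim_pow_at_top inf) auto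
  then have "eventually (\<lambda>m. (\<Sum>i<M. s i) / (a m)\<^sup>2 < d / 2) sequentially"
    using d by (intro order_tendstoD(2)) auto
  then obtain m where m: "M \<le> m" "1 \<le> m" "(\<Sum>i<M. s i) / (a m)\<^sup>2 < d / 2"
    by (metis (no_types, lifting) eventually_sequentially max.cobounded1 max.cobounded2 max.coboundedI2)
  have mono': "a i \<le> a j" if "1 \<le> i" "i \<le> j" for i j
    using that(2)
  proof (induction j rule: dec_induct)
    case (step j)
    then show ?case using mono[of j] that(1) by simp
  qed simp
  show ?thesis
  proof (intro exI[of _ m] conjI allI impI)
    fix n assume n: "m \<le> n"
    have "(\<Sum>i<m. s i) / (a m)\<^sup>2 = (\<Sum>i<M. s i) / (a m)\<^sup>2 + (\<Sum>i=M..<m. s i / (a m)\<^sup>2)"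
      using m(1) by (simp add: sum_divide_distrib lessThan_atLeast0 sum.atLeastLessThan_concat)
    also have "(\<Sum>i=M..<m. s i / (a m)\<^sup>2) \<le> (\<Sum>i=M..<m. s i / (a (Suc i))\<^sup>2)"
    proof (rule sum_mono)
      fix i assume i: "i \<in> {M..<m}"
      have "1 \<le> a (Suc i)" "a (Suc i) \<le> a m" using i by (auto intro!: a1 mono')
      then show "s i / (a m)\<^sup>2 \<le> s i / (a (Suc i))\<^sup>2"
        using s by (intro divide_left_mono power_mono mult_pos_pos) auto
    qed
    finally have "(\<Sum>i<m. s i) / (a m)\<^sup>2 + (\<Sum>i=m..<n. s i / (a (Suc i))\<^sup>2) \<le>
       (\<Sum>i<M. s i) / (a m)\<^sup>2 + (\<Sum>i=M..<n. s i / (a (Suc i))\<^sup>2)"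
      using sum.atLeastLessThan_concat[OF m(1) n, of "\<lambda>i. s i / (a (Suc i))\<^sup>2"] by simp
    then show "(\<Sum>i<m. s i) / (a m)\<^sup>2 + (\<Sum>i=m..<n. s i / (a (Suc i))\<^sup>2) \<le> d"
      using m(3) M[of M n] by linarith
  qed (rule m(2))
qed

subsection \<open>Sub-linear expectations under (CC)\<close>

text \<open>Mixtures are needed because \<open>Ps\<close> is not assumed convex: a mean strictly between the lower and
  the upper one may fail to be attained inside \<open>Ps\<close>.\<close>

lemma mixture_exists:
  fixes M1 M2 :: "real measure"
  assumes M: "prob_space M1" "prob_space M2" "sets M1 = sets borel" "sets M2 = sets borel"
    and p: "0 \<le> p" "p \<le> 1"
  shows "\<exists>N. prob_space N \<and> sets N = sets borel \<and>
    (\<forall>f :: real \<Rightarrow> real. integrable M1 f \<longrightarrow> integrable M2 f \<longrightarrow>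
      integrable N f \<and> integral\<^sup>L N f = p * integral\<^sup>L M1 f + (1 - p) * integral\<^sup>L M2 f)"
proof -
  define K where "K b = (if b then M1 else M2)" for b :: bool
  define N where "N = measure_pmf (bernoulli_pmf p) \<bind> K"
  have K: "K \<in> measure_pmf (bernoulli_pmf p) \<rightarrow>\<^sub>M subprob_algebra borel"
    using M by (auto simp: K_def space_subprob_algebra prob_space_imp_subprob_space)
  have setsN: "sets N = sets borel"
    unfolding N_def using M by (intro sets_bind) (auto simp: K_def)
  have probN: "prob_space N"
    unfolding N_def using M K
    by (intro measure_pmf.prob_space_bind[where S = borel]) (auto simp: K_def)
  have nn: "(\<integral>\<^sup>+y. g y \<partial>N) = (\<integral>\<^sup>+y. g y \<partial>M1) * ennreal p + (\<integral>\<^sup>+y. g y \<partial>M2) * ennreal (1 - p)"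
    if "g \<in> borel_measurable borel" for g :: "real \<Rightarrow> ennreal"
    using that p by (simp add: N_def nn_integral_bind[OF _ K] K_def)
  show ?thesis
  proof (intro exI[of _ N] conjI probN setsN allI impI)
    fix f :: "real \<Rightarrow> real" assume f: "integrable M1 f" "integrable M2 f"
    have fm: "f \<in> borel_measurable borel"
      using borel_measurable_integrable[OF f(1)] measurable_cong_sets[OF M(3) refl] by blast
    have fN: "f \<in> borel_measurable N"
      using fm measurable_cong_sets[OF setsN refl] by blast
    have pos: "integrable N g \<and> integral\<^sup>L N g = p * integral\<^sup>L M1 g + (1 - p) * integral\<^sup>L M2 g"
      if g: "integrable M1 g" "integrable M2 g" "\<And>y. 0 \<le> g y" "g \<in> borel_measurable borel"
      for g :: "real \<Rightarrow> real"
    proof -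
      have "(\<integral>\<^sup>+y. ennreal (g y) \<partial>N) =
          ennreal (integral\<^sup>L M1 g) * ennreal p + ennreal (integral\<^sup>L M2 g) * ennreal (1 - p)"
        using g by (subst nn) (simp_all add: nn_integral_eq_integral)
      also have "\<dots> = ennreal (p * integral\<^sup>L M1 g + (1 - p) * integral\<^sup>L M2 g)"
        using g p by (simp add: mult.commute flip: ennreal_plus ennreal_mult)
      finally have eq: "(\<integral>\<^sup>+y. ennreal (g y) \<partial>N) = ennreal (p * integral\<^sup>L M1 g + (1 - p) * integral\<^sup>L M2 g)" .
      have gN: "g \<in> borel_measurable N"
        using g(4) measurable_cong_sets[OF setsN refl] by blast
      have I: "integrable N g"
        using gN eq g(3) by (intro integrableI_nonneg) auto
      have "0 \<le> p * integral\<^sup>L M1 g + (1 - p) * integral\<^sup>L M2 g"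
        using p g by (intro add_nonneg_nonneg mult_nonneg_nonneg) auto
      with I eq g(3) show ?thesis
        by (simp add: nn_integral_eq_integral)
    qed
    \<comment> \<open>The formula for the mixture is known for non-negative functions only;
      \<open>f\<close> is a difference of two non-negative integrable ones.\<close>
    define g where "g = (\<lambda>y. \<bar>f y\<bar> + f y)"
    define h where "h = (\<lambda>y. \<bar>f y\<bar>)"
    have 1: "integrable N g \<and> integral\<^sup>L N g = p * integral\<^sup>L M1 g + (1 - p) * integral\<^sup>L M2 g"
      unfolding g_def using f fm by (intro pos) auto
    have 2: "integrable N h \<and> integral\<^sup>L N h = p * integral\<^sup>L M1 h + (1 - p) * integral\<^sup>L M2 h"
      unfolding h_def using f fm by (intro pos) auto
    have fg: "f = (\<lambda>y. g y - h y)" by (auto simp: g_def h_def)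
    have gh: "integrable M1 g" "integrable M2 g" "integrable M1 h" "integrable M2 h"
      using f by (auto simp: g_def h_def)
    show "integrable N f"
      unfolding fg using 1 2 by auto
    show "integral\<^sup>L N f = p * integral\<^sup>L M1 f + (1 - p) * integral\<^sup>L M2 f"
      unfolding fg using 1 2 gh by (simp add: algebra_simps)
  qed
qed

lemma le_by_eps_over:
  assumes "\<And>c::real. 0 < c \<Longrightarrow> x \<le> y + C / c" shows "x \<le> y"
proof (rule field_le_epsilon)
  fix e :: real assume e: "0 < e"
  have "x \<le> y + C / ((\<bar>C\<bar> + 1) / e)" using e by (intro assms) auto
  also have "C / ((\<bar>C\<bar> + 1) / e) = C / (\<bar>C\<bar> + 1) * e" by simp
  also have "\<dots> \<le> 1 * e" using e by (intro mult_right_mono) auto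
  finally show "x \<le> y + e" by simp
qed

locale cc_space =
  fixes H :: "('a \<Rightarrow> real) set" and E :: "('a \<Rightarrow> real) \<Rightarrow> ereal" and Ps :: "'a measure set"
  assumes sle: "sublinear_expectation_space H E" and CC: "condition_CC H E Ps"
begin

lemma
  shows H_add: "X \<in> H \<Longrightarrow> Y \<in> H \<Longrightarrow> (\<lambda>w. X w + Y w) \<in> H"
    and H_scale: "X \<in> H \<Longrightarrow> (\<lambda>w. c * X w) \<in> H"
    and H_const: "(\<lambda>_. c) \<in> H"
    and H_comp: "(\<And>i. i < d \<Longrightarrow> Xs i \<in> H) \<Longrightarrow> loc_lip_poly d \<phi> \<Longrightarrow> (\<lambda>w. \<phi> (vecof d Xs w)) \<in> H"
    and E_mono: "X \<in> H \<Longrightarrow> Y \<in> H \<Longrightarrow> (\<And>w. X w \<le> Y w) \<Longrightarrow> E X \<le> E Y"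
    and E_const: "E (\<lambda>_. c) = ereal c"
    and E_add: "X \<in> H \<Longrightarrow> Y \<in> H \<Longrightarrow> E (\<lambda>w. X w + Y w) \<le> E X + E Y"
    and E_scale: "X \<in> H \<Longrightarrow> 0 \<le> c \<Longrightarrow> E (\<lambda>w. c * X w) = ereal c * E X"
  using sle unfolding sublinear_expectation_space_def by simp_all

lemma
  assumes "P \<in> Ps"
  shows P_prob: "prob_space P" and P_space: "space P = UNIV" and P_sets: "sets P = sigmaH H"
  using CC assms unfolding condition_CC_def by simp_all

lemma E_eq_SUP: "X \<in> H \<Longrightarrow> bounded (range X) \<Longrightarrow> E X = (SUP P\<in>Ps. ereal (integral\<^sup>L P X))"
  using CC unfolding condition_CC_def by simp

lemma H_measurable:
  assumes "P \<in> Ps" "X \<in> H" shows "X \<in> borel_measurable P"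
proof (rule measurableI)
  fix B :: "real set" assume "B \<in> sets borel"
  then show "X -` B \<inter> space P \<in> sets P"
    unfolding P_space[OF assms(1)] P_sets[OF assms(1)] sigmaH_def using assms(2)
    by (auto intro!: sigma_sets.Basic)
qed simp

lemma H_lip:
  assumes "\<And>i. i < d \<Longrightarrow> Xs i \<in> H" "lip d f" shows "(\<lambda>w. f (\<lambda>i. Xs i w)) \<in> H"
proof -
  obtain L where L: "0 \<le> L" "\<And>x y. \<bar>f x - f y\<bar> \<le> L * vnorm d (\<lambda>i. x i - y i)"
    using lipE[OF assms(2)] by blast
  have "\<bar>f x - f y\<bar> \<le> L * (1 + vnorm d x ^ 0 + vnorm d y ^ 0) * vnorm d (\<lambda>i. x i - y i)" for x y
    using L(2)[of x y] mult_nonneg_nonneg[OF L(1) vnorm_nonneg[of d "\<lambda>i. x i - y i"]] by simp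
  then have "loc_lip_poly d f"
    unfolding loc_lip_poly_def by blast
  then have "(\<lambda>w. f (vecof d Xs w)) \<in> H"
    using assms(1) by (rule H_comp[rotated])
  moreover have "f (vecof d Xs w) = f (\<lambda>i. Xs i w)" for w
    by (rule lip_cong[OF assms(2)]) (simp add: vecof_def)
  ultimately show ?thesis by simp
qed

lemma H_lip_real:
  assumes "X \<in> H" and f: "\<And>x y. \<bar>f x - f y\<bar> \<le> L * \<bar>x - y\<bar>"
  shows "(\<lambda>w. f (X w)) \<in> H"
proof -
  have "lip 1 (\<lambda>x. f (x 0))"
    using f by (intro lipI[where L = L]) (simp add: vnorm_1)
  from H_lip[of 1 "\<lambda>_. X", OF assms(1) this] show ?thesis .
qed

lemma H_clip: "X \<in> H \<Longrightarrow> (\<lambda>w. clip c (X w)) \<in> H"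
  by (rule H_lip_real[where L = 1]) (auto simp: clip_def)

lemma H_uminus: "X \<in> H \<Longrightarrow> (\<lambda>w. - X w) \<in> H"
  using H_scale[of X "-1"] by simp

lemma H_square:
  assumes "X \<in> H" shows "(\<lambda>w. (X w)\<^sup>2) \<in> H"
proof -
  have le: "\<bar>x\<^sup>2 - y\<^sup>2\<bar> \<le> (1 + \<bar>x\<bar> + \<bar>y\<bar>) * \<bar>x - y\<bar>" for x y :: real
  proof -
    have "\<bar>x\<^sup>2 - y\<^sup>2\<bar> = \<bar>x + y\<bar> * \<bar>x - y\<bar>"
      by (simp add: power2_eq_square square_diff_square_factored abs_mult)
    also have "\<dots> \<le> (1 + \<bar>x\<bar> + \<bar>y\<bar>) * \<bar>x - y\<bar>"
      by (intro mult_right_mono) auto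
    finally show ?thesis .
  qed
  have "loc_lip_poly 1 (\<lambda>x. (x 0)\<^sup>2)"
    unfolding loc_lip_poly_def using le
    by (intro exI[of _ 1] exI[of _ 1]) (simp add: vnorm_1)
  from H_comp[of 1 "\<lambda>_. X", OF assms this] show ?thesis by (simp add: vecof_def)
qed

section \<open>Real-valued calculus for variables with finite expectations\<close>

definition rE :: "('a \<Rightarrow> real) \<Rightarrow> real" where
  "rE X = real_of_ereal (E X)"

text \<open>Bounding both \<open>E X\<close> and \<open>E (- X)\<close> keeps \<open>E\<close> away from both infinities, so that \<open>rE\<close> is
  not a junk value and the domain is stable under addition.\<close>

definition fin :: "('a \<Rightarrow> real) \<Rightarrow> bool" where
  "fin X \<longleftrightarrow> X \<in> H \<and> E X < \<infinity> \<and> E (\<lambda>w. - X w) < \<infinity>"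

lemma fin_H: "fin X \<Longrightarrow> X \<in> H"
  by (simp add: fin_def)

lemma E_eq_rE: "fin X \<Longrightarrow> E X = ereal (rE X)"
proof -
  assume X: "fin X"
  \<comment> \<open>If \<open>E X\<close> were minus infinity, the right-hand side would be too, as
    \<open>E\<close> of \<open>- X\<close> is not plus infinity; but the left-hand side is
    0.\<close>
  have "E (\<lambda>w. 0) \<le> E X + E (\<lambda>w. - X w)"
    using E_add[OF fin_H[OF X] H_uminus[OF fin_H[OF X]]] by simp
  then have "E X \<noteq> - \<infinity>"
    using X unfolding fin_def E_const by (cases "E (\<lambda>w. - X w)") auto
  then show ?thesis
    using X unfolding fin_def rE_def by (cases "E X") auto
qed

lemma fin_uminus: "fin X \<Longrightarrow> fin (\<lambda>w. - X w)"
  by (simp add: fin_def H_uminus)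

lemma fin_const: "fin (\<lambda>_. c)"
  by (simp add: fin_def H_const E_const)

lemma fin_add:
  assumes "fin X" "fin Y" shows "fin (\<lambda>w. X w + Y w)"
proof -
  have "E (\<lambda>w. X w + Y w) \<le> ereal (rE X) + ereal (rE Y)"
    using E_add[of X Y] assms by (simp add: fin_H flip: E_eq_rE)
  moreover have "E (\<lambda>w. - (X w + Y w)) \<le> ereal (rE (\<lambda>w. - X w)) + ereal (rE (\<lambda>w. - Y w))"
    using E_add[of "\<lambda>w. - X w" "\<lambda>w. - Y w"] assms
    by (simp add: fin_H fin_uminus flip: E_eq_rE)
  ultimately show ?thesis
    using assms unfolding fin_def
    by (auto intro!: H_add intro: le_less_trans)
qed

lemma fin_scale: 
  assumes "fin X" "0 \<le> c" shows "fin (\<lambda>w. c * X w)"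
  using E_scale[of X c] E_scale[of "\<lambda>w. - X w" c] assms E_eq_rE[OF assms(1)] E_eq_rE[OF fin_uminus[OF assms(1)]]
  by (simp add: fin_def H_scale H_uminus)

lemma fin_sum: "(\<And>i. i \<in> A \<Longrightarrow> fin (X i)) \<Longrightarrow> fin (\<lambda>w. \<Sum>i\<in>A. X i w)"
  by (induction A rule: infinite_finite_induct) (auto intro: fin_add fin_const)

lemma rE_mono: "fin X \<Longrightarrow> fin Y \<Longrightarrow> (\<And>w. X w \<le> Y w) \<Longrightarrow> rE X \<le> rE Y"
  using E_mono[of X Y] by (simp add: fin_H E_eq_rE)

lemma rE_const: "rE (\<lambda>_. c) = c"
  by (simp add: rE_def E_const)

lemma rE_add: "fin X \<Longrightarrow> fin Y \<Longrightarrow> rE (\<lambda>w. X w + Y w) \<le> rE X + rE Y"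
  using E_add[of X Y] by (simp add: fin_H fin_add E_eq_rE)

lemma rE_scale: "fin X \<Longrightarrow> 0 \<le> c \<Longrightarrow> rE (\<lambda>w. c * X w) = c * rE X"
  using E_scale[of X c] by (simp add: fin_H fin_scale E_eq_rE)

lemma rE_sum: "finite A \<Longrightarrow> (\<And>i. i \<in> A \<Longrightarrow> fin (X i)) \<Longrightarrow> rE (\<lambda>w. \<Sum>i\<in>A. X i w) \<le> (\<Sum>i\<in>A. rE (X i))"
proof (induction A rule: finite_induct)
  case (insert i A)
  then have "rE (\<lambda>w. X i w + (\<Sum>i\<in>A. X i w)) \<le> rE (X i) + rE (\<lambda>w. \<Sum>i\<in>A. X i w)"
    by (intro rE_add fin_sum) auto
  with insert show ?case by fastforce
qed (simp add: rE_const)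

lemma fin_dominated:
  assumes "X \<in> H" "fin Y" "\<And>w. \<bar>X w\<bar> \<le> Y w" shows "fin X"
proof -
  have "X w \<le> Y w" "- X w \<le> Y w" for w using assms(3)[of w] by auto
  then have "E X \<le> E Y" "E (\<lambda>w. - X w) \<le> E Y"
    using assms by (auto intro!: E_mono fin_H H_uminus)
  then show ?thesis using assms(1,2) unfolding fin_def by auto
qed

lemma fin_bounded: "X \<in> H \<Longrightarrow> bounded (range X) \<Longrightarrow> fin X"
  unfolding bounded_iff by (auto intro: fin_dominated[OF _ fin_const])

lemma fin_clip: "X \<in> H \<Longrightarrow> 0 \<le> c \<Longrightarrow> fin (\<lambda>w. clip c (X w))"
  by (rule fin_dominated[OF H_clip fin_const]) (auto intro: abs_clip_le)

section \<open>Variables with finite second moment\<close>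

definition L2 :: "('a \<Rightarrow> real) \<Rightarrow> bool" where
  "L2 X \<longleftrightarrow> X \<in> H \<and> E (\<lambda>w. (X w)\<^sup>2) < \<infinity>"

lemma L2_H: "L2 X \<Longrightarrow> X \<in> H"
  by (simp add: L2_def)

lemma L2_fin_square: "L2 X \<Longrightarrow> fin (\<lambda>w. (X w)\<^sup>2)"
  using E_mono[of "\<lambda>w. - ((X w)\<^sup>2)" "\<lambda>w. 0"]
  by (auto simp: L2_def fin_def H_square H_uminus H_const E_const)

lemma L2I: "X \<in> H \<Longrightarrow> fin (\<lambda>w. (X w)\<^sup>2) \<Longrightarrow> L2 X"
  by (simp add: L2_def fin_def)

lemma L2_fin:
  assumes "L2 X" shows "fin X"
proof (rule fin_dominated[OF L2_H[OF assms]])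
  show "fin (\<lambda>w. 1 + (X w)\<^sup>2)"
    by (intro fin_add fin_const L2_fin_square assms)
  show "\<bar>X w\<bar> \<le> 1 + (X w)\<^sup>2" for w
    using zero_le_power2[of "\<bar>X w\<bar> - 1"] zero_le_power2[of "X w"]
    by (simp add: power2_diff)
qed

lemma L2_uminus: "L2 X \<Longrightarrow> L2 (\<lambda>w. - X w)"
  by (simp add: L2_def H_uminus)

lemma L2_add:
  assumes "L2 X" "L2 Y" shows "L2 (\<lambda>w. X w + Y w)"
proof (rule L2I)
  show XY: "(\<lambda>w. X w + Y w) \<in> H" using assms by (intro H_add L2_H)
  show "fin (\<lambda>w. (X w + Y w)\<^sup>2)"
  proof (rule fin_dominated[OF H_square[OF XY]])
    show "fin (\<lambda>w. 2 * (X w)\<^sup>2 + 2 * (Y w)\<^sup>2)"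
      using assms by (intro fin_add fin_scale L2_fin_square) auto
    have "(X w + Y w)\<^sup>2 \<le> 2 * (X w)\<^sup>2 + 2 * (Y w)\<^sup>2" for w
      using zero_le_power2[of "X w - Y w"] by (simp add: power2_diff power2_sum)
    then show "\<bar>(X w + Y w)\<^sup>2\<bar> \<le> 2 * (X w)\<^sup>2 + 2 * (Y w)\<^sup>2" for w
      by simp
  qed
qed

lemma L2_const: "L2 (\<lambda>_. c)"
  by (simp add: L2_def H_const E_const)

lemma L2_sum: "(\<And>i. i \<in> A \<Longrightarrow> L2 (X i)) \<Longrightarrow> L2 (\<lambda>w. \<Sum>i\<in>A. X i w)"
  by (induction A rule: infinite_finite_induct) (auto intro: L2_add L2_const)

lemma rE_square_nonneg: "L2 X \<Longrightarrow> 0 \<le> rE (\<lambda>w. (X w)\<^sup>2)"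
  using rE_mono[OF fin_const[of 0] L2_fin_square] by (simp add: rE_const)

text \<open>\<open>X\<close> and its truncation differ pointwise by at most the square of
  \<open>X\<close> over \<open>c\<close>, so monotonicity and sub-additivity compare their
  expectations in both directions.\<close>

lemma rE_clip_close:
  assumes X: "L2 X" and c: "0 < c"
  shows "\<bar>rE (\<lambda>w. clip c (X w)) - rE X\<bar> \<le> rE (\<lambda>w. (X w)\<^sup>2) / c"
proof -
  define R where "R = (\<lambda>w. inverse c * (X w)\<^sup>2)"
  have R: "fin R" "rE R = rE (\<lambda>w. (X w)\<^sup>2) / c"
    using c X unfolding R_def
    by (auto simp: fin_scale rE_scale L2_fin_square divide_inverse mult.commute)
  have le: "\<bar>clip c (X w) - X w\<bar> \<le> R w" for w
    using abs_clip_diff_le[OF c, of "X w"] by (simp add: R_def divide_inverse mult.commute)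
  have C: "fin (\<lambda>w. clip c (X w))" using X c by (intro fin_clip L2_H) auto
  have F: "fin X" by (rule L2_fin[OF X])
  have "rE (\<lambda>w. clip c (X w)) \<le> rE (\<lambda>w. X w + R w)"
    using le C R F by (intro rE_mono fin_add) (auto simp: abs_le_iff algebra_simps)
  also have "\<dots> \<le> rE X + rE R" using R X by (intro rE_add F)
  finally have 1: "rE (\<lambda>w. clip c (X w)) \<le> rE X + rE R" .
  have "rE X \<le> rE (\<lambda>w. clip c (X w) + R w)"
    using le C R F by (intro rE_mono fin_add) (auto simp: abs_le_iff algebra_simps)
  also have "\<dots> \<le> rE (\<lambda>w. clip c (X w)) + rE R" using R C by (intro rE_add)
  finally show ?thesis using 1 R by linarith
qed

section \<open>Members of \<open>Ps\<close> compared with the sub-linear expectation\<close>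

lemma P_integrable_bounded:
  assumes "P \<in> Ps" "X \<in> H" "bounded (range X)" shows "integrable P X"
proof -
  interpret prob_space P by (rule P_prob[OF assms(1)])
  obtain B where "\<And>w. norm (X w) \<le> B" using assms(3) unfolding bounded_iff by auto
  then show ?thesis
    using H_measurable[OF assms(1,2)] by (intro integrable_const_bound[where B = B]) auto
qed

lemma P_le_rE_bounded:
  assumes "P \<in> Ps" "X \<in> H" "bounded (range X)" shows "integral\<^sup>L P X \<le> rE X"
proof -
  have "ereal (integral\<^sup>L P X) \<le> E X"
    unfolding E_eq_SUP[OF assms(2,3)] using assms(1) by (intro SUP_upper)
  then show ?thesis using assms by (simp add: E_eq_rE fin_bounded)
qed

lemma rE_approx:
  assumes "X \<in> H" "bounded (range X)" "0 < e" shows "\<exists>P\<in>Ps. rE X - e < integral\<^sup>L P X"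
proof -
  have "ereal (rE X - e) < (SUP P\<in>Ps. ereal (integral\<^sup>L P X))"
    using assms by (simp add: E_eq_rE fin_bounded flip: E_eq_SUP)
  then show ?thesis unfolding less_SUP_iff by simp
qed

lemma bounded_clip: "0 \<le> c \<Longrightarrow> bounded (range (\<lambda>w. clip c (X w)))"
  unfolding bounded_iff by (auto intro!: exI[of _ c] abs_clip_le)

text \<open>The square is unbounded and out of direct reach of (CC). Its truncations are bounded and
  below it, so their integrals stay below \<open>rE\<close> of the square, and Fatou's lemma passes
  to the limit.\<close>

lemma P_square:
  assumes P: "P \<in> Ps" and X: "L2 X"
  shows "integrable P (\<lambda>w. (X w)\<^sup>2)" "integral\<^sup>L P (\<lambda>w. (X w)\<^sup>2) \<le> rE (\<lambda>w. (X w)\<^sup>2)"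
proof -
  define C where "C = rE (\<lambda>w. (X w)\<^sup>2)"
  have XH: "X \<in> H" by (rule L2_H[OF X])
  have m: "(\<lambda>w. (X w)\<^sup>2) \<in> borel_measurable P" by (rule H_measurable[OF P H_square[OF XH]])
  have lim: "(\<lambda>n. clip (real n) ((X w)\<^sup>2)) \<longlonglongrightarrow> (X w)\<^sup>2" for w
  proof (rule tendsto_eventually)
    show "eventually (\<lambda>n. clip (real n) ((X w)\<^sup>2) = (X w)\<^sup>2) sequentially"
      using eventually_ge_at_top[of "nat \<lceil>(X w)\<^sup>2\<rceil>"]
    proof eventually_elim
      case (elim n)
      then have "(X w)\<^sup>2 \<le> real n" by linarith
      then show ?case unfolding clip_def using zero_le_power2[of "X w"] by linarith
    qed
  qed
  have nn: "0 \<le> clip (real n) ((X w)\<^sup>2)" for n w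
    unfolding clip_def using zero_le_power2[of "X w"] by linarith
  have "(\<integral>\<^sup>+w. ennreal ((X w)\<^sup>2) \<partial>P) = (\<integral>\<^sup>+w. liminf (\<lambda>n. ennreal (clip (real n) ((X w)\<^sup>2))) \<partial>P)"
    using lim_imp_Liminf[OF _ tendsto_ennrealI[OF lim]] by simp
  also have "\<dots> \<le> liminf (\<lambda>n. \<integral>\<^sup>+w. ennreal (clip (real n) ((X w)\<^sup>2)) \<partial>P)"
    using H_measurable[OF P H_clip[OF H_square[OF XH]]] by (intro nn_integral_liminf) auto
  also have "\<dots> \<le> ennreal C"
  proof (rule Liminf_le)
    show "eventually (\<lambda>n. (\<integral>\<^sup>+w. ennreal (clip (real n) ((X w)\<^sup>2)) \<partial>P) \<le> ennreal C) sequentially"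
    proof (rule always_eventually, rule allI)
      fix n
      have b: "(\<lambda>w. clip (real n) ((X w)\<^sup>2)) \<in> H" "bounded (range (\<lambda>w. clip (real n) ((X w)\<^sup>2)))"
        by (auto intro!: H_clip H_square XH bounded_clip)
      have "integral\<^sup>L P (\<lambda>w. clip (real n) ((X w)\<^sup>2)) \<le> rE (\<lambda>w. clip (real n) ((X w)\<^sup>2))"
        by (rule P_le_rE_bounded[OF P b])
      also have "\<dots> \<le> C"
        unfolding C_def by (intro rE_mono fin_bounded[OF b] L2_fin_square X) (auto simp: clip_def intro: order_trans[of _ 0])
      finally show "(\<integral>\<^sup>+w. ennreal (clip (real n) ((X w)\<^sup>2)) \<partial>P) \<le> ennreal C"
        using nn P_integrable_bounded[OF P b] by (simp add: nn_integral_eq_integral ennreal_leI)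
    qed
  qed simp
  finally have le: "(\<integral>\<^sup>+w. ennreal ((X w)\<^sup>2) \<partial>P) \<le> ennreal C" .
  show I: "integrable P (\<lambda>w. (X w)\<^sup>2)"
    using m le by (intro integrableI_nonneg) (auto intro: le_less_trans)
  show "integral\<^sup>L P (\<lambda>w. (X w)\<^sup>2) \<le> rE (\<lambda>w. (X w)\<^sup>2)"
    using le I rE_square_nonneg[OF X] by (simp add: nn_integral_eq_integral C_def)
qed

lemma P_integrable:
  assumes P: "P \<in> Ps" and X: "L2 X" shows "integrable P X"
proof -
  interpret prob_space P by (rule P_prob[OF P])
  show ?thesis
  proof (rule Bochner_Integration.integrable_bound)
    show "integrable P (\<lambda>w. 1 + (X w)\<^sup>2)" using P_square(1)[OF P X] by simp
    show "X \<in> borel_measurable P" by (rule H_measurable[OF P L2_H[OF X]])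
    show "AE w in P. norm (X w) \<le> norm (1 + (X w)\<^sup>2)"
    proof (rule AE_I2)
      show "norm (X w) \<le> norm (1 + (X w)\<^sup>2)" for w
        using zero_le_power2[of "\<bar>X w\<bar> - 1"] zero_le_power2[of "X w"]
        by (simp add: power2_diff)
    qed
  qed
qed

lemma P_clip_close:
  assumes P: "P \<in> Ps" and X: "L2 X" and c: "0 < c"
  shows "\<bar>integral\<^sup>L P (\<lambda>w. clip c (X w)) - integral\<^sup>L P X\<bar> \<le> rE (\<lambda>w. (X w)\<^sup>2) / c"
proof -
  have I: "integrable P (\<lambda>w. clip c (X w))"
    using c by (intro P_integrable_bounded P H_clip L2_H X bounded_clip) auto
  have "\<bar>integral\<^sup>L P (\<lambda>w. clip c (X w)) - integral\<^sup>L P X\<bar> = \<bar>\<integral>w. clip c (X w) - X w \<partial>P\<bar>"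
    using I P_integrable[OF P X] by simp
  also have "\<dots> \<le> (\<integral>w. \<bar>clip c (X w) - X w\<bar> \<partial>P)"
    by (rule integral_abs_bound)
  also have "\<dots> \<le> (\<integral>w. (X w)\<^sup>2 / c \<partial>P)"
    using I P_integrable[OF P X] P_square(1)[OF P X] abs_clip_diff_le[OF c]
    by (intro integral_mono) auto
  also have "\<dots> \<le> rE (\<lambda>w. (X w)\<^sup>2) / c"
    using P_square(2)[OF P X] c by (simp add: divide_right_mono)
  finally show ?thesis .
qed

lemma P_le_rE:
  assumes P: "P \<in> Ps" and X: "L2 X"
  shows "integral\<^sup>L P X \<le> rE X"
proof (rule le_by_eps_over)
  fix c :: real assume c: "0 < c"
  have "integral\<^sup>L P (\<lambda>w. clip c (X w)) \<le> rE (\<lambda>w. clip c (X w))"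
    using c by (intro P_le_rE_bounded P H_clip L2_H X bounded_clip) auto
  then show "integral\<^sup>L P X \<le> rE X + (2 * rE (\<lambda>w. (X w)\<^sup>2)) / c"
    using P_clip_close[OF P X c] rE_clip_close[OF X c] by linarith
qed

text \<open>One subsequence serves every \<open>Y i\<close>. The coordinate map is not a bounded
  test function, but its truncation at a bound of \<open>Y i\<close> is, and it agrees with the
  coordinate on the range of \<open>Y i\<close>.\<close>

lemma compactness:
  assumes Y: "\<And>i. Y i \<in> H" "\<And>i. bounded (range (Y i))" and Pn: "\<And>n :: nat. Pn n \<in> Ps"
  shows "\<exists>r P. strict_mono r \<and> P \<in> Ps \<and>
    (\<forall>i :: nat. (\<lambda>k. integral\<^sup>L (Pn (r k)) (Y i)) \<longlonglongrightarrow> integral\<^sup>L P (Y i))"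
proof -
  obtain r P where r: "strict_mono r" "P \<in> Ps" and lim: "\<And>d \<phi>. 1 \<le> d \<Longrightarrow> bdd_lip d \<phi> \<Longrightarrow>
      (\<lambda>k. integral\<^sup>L (Pn (r k)) (\<lambda>w. \<phi> (vecof d Y w))) \<longlonglongrightarrow> integral\<^sup>L P (\<lambda>w. \<phi> (vecof d Y w))"
    using CC Y Pn unfolding condition_CC_def by (metis image_subsetI)
  have "(\<lambda>k. integral\<^sup>L (Pn (r k)) (Y i)) \<longlonglongrightarrow> integral\<^sup>L P (Y i)" for i
  proof -
    obtain B where B: "0 < B" "\<And>w. \<bar>Y i w\<bar> \<le> B"
      using Y(2)[of i] unfolding bounded_pos by auto
    have "bdd_lip (Suc i) (\<lambda>x. clip B (x i))"
      unfolding bdd_lip_iff using B by (intro conjI bounded_clip lip_clip lip_coord) auto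
    from lim[OF _ this] have "(\<lambda>k. integral\<^sup>L (Pn (r k)) (\<lambda>w. clip B (Y i w))) \<longlonglongrightarrow> integral\<^sup>L P (\<lambda>w. clip B (Y i w))"
      by (simp add: vecof_def)
    moreover have "clip B (Y i w) = Y i w" for w
      using B(2)[of w] unfolding clip_def by linarith
    ultimately show ?thesis by simp
  qed
  then show ?thesis using r by blast
qed

text \<open>Near-maximisers of better and better truncations are near-maximisers of \<open>X\<close>
  itself. For a fixed truncation level the weak limit keeps the value up to the truncation error,
  which vanishes when the level grows afterwards.\<close>

lemma attained:
  assumes X: "L2 X"
  shows "\<exists>P\<in>Ps. integral\<^sup>L P X = rE X"
proof -
  define C where "C = rE (\<lambda>w. (X w)\<^sup>2)"
  define K where "K n = (\<lambda>w. clip (real (Suc n)) (X w))" for n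
  have K: "K n \<in> H" "bounded (range (K n))" for n
    unfolding K_def by (intro H_clip L2_H X) (intro bounded_clip, simp)
  have "\<exists>P. P \<in> Ps \<and> rE (K n) - 1 / real (Suc n) < integral\<^sup>L P (K n)" for n
    using rE_approx[OF K(1,2)[of n], of "1 / real (Suc n)"] by auto
  then obtain Pn where Pn: "\<And>n. Pn n \<in> Ps"
    "\<And>n. rE (K n) - 1 / real (Suc n) < integral\<^sup>L (Pn n) (K n)" by metis
  obtain r P where r: "strict_mono r" and P: "P \<in> Ps" and
    lim: "\<And>i. (\<lambda>k. integral\<^sup>L (Pn (r k)) (K i)) \<longlonglongrightarrow> integral\<^sup>L P (K i)"
    using compactness[of K Pn] K Pn(1) by metis
  \<comment> \<open>The 1 is the slack in the choice of \<open>Pn n\<close>; \<open>2 * C\<close>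
    comes from truncating once under \<open>rE\<close> and once under \<open>Pn n\<close>.\<close>
  have near: "rE X - (1 + 2 * C) / real (Suc n) \<le> integral\<^sup>L (Pn n) X" for n
    using Pn(2)[of n] rE_clip_close[OF X, of "real (Suc n)"] P_clip_close[OF Pn(1) X, of "real (Suc n)" n]
    unfolding K_def[symmetric] C_def[symmetric] by (auto simp: add_divide_distrib abs_le_iff)
  have a1: "rE X \<le> integral\<^sup>L P (K m) + C / real (Suc m)" for m
  proof -
    have "rE X - (1 + 2 * C) / real (Suc (r k)) - C / real (Suc m) \<le> integral\<^sup>L (Pn (r k)) (K m)" for k
      using near[of "r k"] P_clip_close[OF Pn(1) X, of "real (Suc m)" "r k"]
      unfolding K_def[symmetric] C_def[symmetric] by (auto simp: abs_le_iff)
    moreover have "((\<lambda>k. rE X - (1 + 2 * C) / real (Suc (r k)) - C / real (Suc m)) \<longlongrightarrow> rE X - 0 - C / real (Suc m)) sequentially"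
      using LIMSEQ_subseq_LIMSEQ[OF LIMSEQ_Suc[OF lim_const_over_n[of "1 + 2 * C"]] r]
      by (intro tendsto_diff tendsto_const) (simp add: comp_def)
    ultimately have "rE X - 0 - C / real (Suc m) \<le> integral\<^sup>L P (K m)"
      using lim[of m] by (intro LIMSEQ_le[of _ _ "\<lambda>k. integral\<^sup>L (Pn (r k)) (K m)"]) auto
    then show ?thesis by simp
  qed
  have le: "rE X \<le> integral\<^sup>L P X + 2 * C / real (Suc m)" for m
  proof -
    have "integral\<^sup>L P (K m) \<le> integral\<^sup>L P X + C / real (Suc m)"
      using P_clip_close[OF P X, of "real (Suc m)"]
      unfolding K_def[symmetric] C_def[symmetric] by (simp add: abs_le_iff)
    moreover have "2 * C / real (Suc m) = C / real (Suc m) + C / real (Suc m)" by simp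
    ultimately show ?thesis using a1[of m] by linarith
  qed
  have "(\<lambda>m. integral\<^sup>L P X + 2 * C / real (Suc m)) \<longlonglongrightarrow> integral\<^sup>L P X + 0"
    using LIMSEQ_Suc[OF lim_const_over_n[of "2 * C"]] by (intro tendsto_add tendsto_const)
  then have "rE X \<le> integral\<^sup>L P X"
    using le by (intro LIMSEQ_le_const) auto
  then show ?thesis using P P_le_rE[OF P X] by (intro bexI[of _ P]) auto
qed

end

subsection \<open>Product laws dominated by the sub-linear expectation\<close>

context cc_space
begin

text \<open>Measures attaining the upper mean of \<open>X\<close> and of \<open>- X\<close> give
  laws with the two extremal means; a convex combination hits \<mu>. All the required upper bounds
  hold for both laws, hence for the mixture, which lives on the real line and need not be a law
  under a member of \<open>Ps\<close>.\<close>

lemma dominated_law: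
  assumes X: "L2 X" and mu: "- rE (\<lambda>w. - X w) \<le> \<mu>" "\<mu> \<le> rE X"
  shows "\<exists>N. prob_space N \<and> sets N = sets borel \<and>
    integrable N (\<lambda>y. y) \<and> integrable N (\<lambda>y. y\<^sup>2) \<and> integral\<^sup>L N (\<lambda>y. y) = \<mu> \<and>
    integral\<^sup>L N (\<lambda>y. y\<^sup>2) \<le> rE (\<lambda>w. (X w)\<^sup>2) \<and>
    (\<forall>f L. (\<forall>x y. \<bar>f x - f y\<bar> \<le> L * \<bar>x - y\<bar>) \<longrightarrow> bounded (range f) \<longrightarrow>
      integral\<^sup>L N f \<le> rE (\<lambda>w. f (X w)))"
proof -
  obtain P1 where P1: "P1 \<in> Ps" "integral\<^sup>L P1 X = rE X"
    using attained[OF X] by blast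
  obtain P2 where P2: "P2 \<in> Ps" "integral\<^sup>L P2 (\<lambda>w. - X w) = rE (\<lambda>w. - X w)"
    using attained[OF L2_uminus[OF X]] by blast
  define u where "u = rE X"
  define l where "l = - rE (\<lambda>w. - X w)"
  obtain p where p: "0 \<le> p" "p \<le> 1" "\<mu> = p * u + (1 - p) * l"
  proof (cases "u = l")
    case True
    then show ?thesis using that[of 1] mu by (simp add: u_def l_def)
  next
    case False
    then have ul: "l < u" using mu by (simp add: u_def l_def)
    define p where "p = (\<mu> - l) / (u - l)"
    have "p * (u - l) = \<mu> - l" using ul by (simp add: p_def)
    then have "\<mu> = p * u + (1 - p) * l" by (simp add: algebra_simps)
    moreover have "0 \<le> p" "p \<le> 1" using ul mu by (auto simp: p_def u_def l_def)
    ultimately show ?thesis using that by blast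
  qed
  have m[measurable]: "X \<in> borel_measurable P1" "X \<in> borel_measurable P2"
    using H_measurable[OF _ L2_H[OF X]] P1 P2 by auto
  have d1: "prob_space (distr P1 borel X)"
    by (rule prob_space.prob_space_distr[OF P_prob[OF P1(1)] m(1)])
  have d2: "prob_space (distr P2 borel X)"
    by (rule prob_space.prob_space_distr[OF P_prob[OF P2(1)] m(2)])
  obtain N where N: "prob_space N" "sets N = sets borel"
    and mix: "\<And>f :: real \<Rightarrow> real. integrable (distr P1 borel X) f \<Longrightarrow> integrable (distr P2 borel X) f \<Longrightarrow>
      integrable N f \<and> integral\<^sup>L N f = p * integral\<^sup>L (distr P1 borel X) f + (1 - p) * integral\<^sup>L (distr P2 borel X) f"
    using mixture_exists[OF d1 d2 sets_distr sets_distr p(1,2)] by metis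
  have mix': "integrable N f \<and> integral\<^sup>L N f = p * (\<integral>w. f (X w) \<partial>P1) + (1 - p) * (\<integral>w. f (X w) \<partial>P2)"
    if "f \<in> borel_measurable borel" "integrable P1 (\<lambda>w. f (X w))" "integrable P2 (\<lambda>w. f (X w))" for f :: "real \<Rightarrow> real"
    using mix[of f] that by (simp add: integrable_distr_eq integral_distr)
  have conv: "p * x + (1 - p) * y \<le> z" if "x \<le> z" "y \<le> z" for x y z :: real
    using convex_bound_le[OF that, of p "1 - p"] p by simp
  have "integral\<^sup>L P2 X = l"
    using P2(2) by (simp add: l_def)
  then have 1: "integrable N (\<lambda>y. y) \<and> integral\<^sup>L N (\<lambda>y. y) = \<mu>"
    using mix'[of "\<lambda>y. y"] P_integrable[OF P1(1) X] P_integrable[OF P2(1) X] P1(2) p(3)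
    by (simp add: u_def)
  have sq: "integrable N (\<lambda>y. y\<^sup>2) \<and> integral\<^sup>L N (\<lambda>y. y\<^sup>2) =
      p * (\<integral>w. (X w)\<^sup>2 \<partial>P1) + (1 - p) * (\<integral>w. (X w)\<^sup>2 \<partial>P2)"
    using P_square(1)[OF P1(1) X] P_square(1)[OF P2(1) X] by (intro mix') auto
  have dom: "integral\<^sup>L N f \<le> rE (\<lambda>w. f (X w))"
    if f: "\<forall>x y. \<bar>f x - f y\<bar> \<le> L * \<bar>x - y\<bar>" "bounded (range f)" for f :: "real \<Rightarrow> real" and L
  proof -
    have fX: "(\<lambda>w. f (X w)) \<in> H" "bounded (range (\<lambda>w. f (X w)))"
      using f by (auto intro!: H_lip_real[OF L2_H[OF X], of f L] intro: bounded_subset)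
    have "lip 1 (\<lambda>x. f (x 0))"
      using f(1) by (intro lipI[where L = L]) (simp add: vnorm_1)
    from lip_fun_upd_measurable[OF this, of "\<lambda>_. 0" 0]
    have "f \<in> borel_measurable borel" by simp
    then have "integral\<^sup>L N f = p * (\<integral>w. f (X w) \<partial>P1) + (1 - p) * (\<integral>w. f (X w) \<partial>P2)"
      using mix' P_integrable_bounded[OF P1(1) fX] P_integrable_bounded[OF P2(1) fX] by blast
    also have "\<dots> \<le> rE (\<lambda>w. f (X w))"
      by (intro conv P_le_rE_bounded P1 P2 fX)
    finally show ?thesis .
  qed
  show ?thesis
    using N 1 sq dom conv[OF P_square(2)[OF P1(1) X] P_square(2)[OF P2(1) X]]
    by (intro exI[of _ N]) auto
qed

end

locale cc_seq = cc_space H E Ps + marginals \<nu> \<mu> s a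
  for H :: "('a \<Rightarrow> real) set" and E and Ps and \<nu> \<mu> s a +
  fixes X :: "nat \<Rightarrow> 'a \<Rightarrow> real"
  assumes XL2: "\<And>i. L2 (X i)"
    and indep: "\<And>n. indep_of E n X (X n)"
    and dom: "\<And>i f L. (\<And>x y. \<bar>f x - f y\<bar> \<le> L * \<bar>x - y\<bar>) \<Longrightarrow> bounded (range f) \<Longrightarrow>
      integral\<^sup>L (\<nu> i) f \<le> rE (\<lambda>w. f (X i w))"
begin

abbreviation path :: "'a \<Rightarrow> nat \<Rightarrow> real" where
  "path w \<equiv> (\<lambda>i. X i w)"

lemma vnorm_upd: "vnorm (Suc n) (\<lambda>i. (x(n := y)) i - (x'(n := y)) i) = vnorm n (\<lambda>i. x i - x' i)"
  by (simp add: vnorm_def)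

lemma vnorm_upd2: "vnorm (Suc n) (\<lambda>i. (x(n := y)) i - (x(n := y')) i) = \<bar>y - y'\<bar>"
  by (simp add: vnorm_def)

lemma H_path: "lip n f \<Longrightarrow> (\<lambda>w. f (path w)) \<in> H"
  by (rule H_lip[OF L2_H[OF XL2]])

lemma bounded_path: "bounded (range f) \<Longrightarrow> bounded (range (\<lambda>w. f (path w)))"
  by (erule bounded_subset) auto

lemma Q_integrable: "lip n f \<Longrightarrow> bounded (range f) \<Longrightarrow> integrable (Q n) f"
proof -
  assume f: "lip n f" "bounded (range f)"
  interpret Qn: prob_space "Q n" by (rule Q_prob)
  obtain B where "\<And>x. norm (f x) \<le> B" using f(2) unfolding bounded_iff by auto
  then show ?thesis
    by (intro Qn.integrable_const_bound[where B = B] lip_measurable_PiM f sets_eq) auto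
qed

text \<open>Induction on the number of coordinates. Integrating out the last one against its
  marginal gives \<open>F\<close>, the sub-linear expectation in its place gives \<open>G\<close>,
  and \<open>F\<close> is below \<open>G\<close> by domination. The induction hypothesis applies to
  \<open>F\<close>, monotonicity replaces it by \<open>G\<close>, and independence reassembles
  \<open>f\<close>. Both are shown bounded and Lipschitz so that they yield members of
  \<open>H\<close>.\<close>

lemma Q_le_rE:
  "bdd_lip n f \<Longrightarrow> integral\<^sup>L (Q n) f \<le> rE (\<lambda>w. f (path w))"
proof (induction n arbitrary: f)
  case 0
  then have "f = (\<lambda>_. f undefined)"
    using lip_cong[of 0 f] by (auto simp: bdd_lip_iff)
  then have "\<exists>c. f = (\<lambda>_. c)" by blast
  then show ?case
    using prob_space.prob_space[OF Q_prob[of 0]] by (auto simp: rE_const)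
next
  case (Suc n)
  from Suc.prems have lf: "lip (Suc n) f" and bf: "bounded (range f)" by (auto simp: bdd_lip_iff)
  obtain L where L: "0 \<le> L" "\<And>x y. \<bar>f x - f y\<bar> \<le> L * vnorm (Suc n) (\<lambda>i. x i - y i)"
    using lipE[OF lf] by blast
  obtain B where B: "\<And>x. \<bar>f x\<bar> \<le> B" using bf unfolding bounded_iff by auto
  have B0: "0 \<le> B" using B[of undefined] by linarith
  define F where "F x = (\<integral>y. f (x(n := y)) \<partial>\<nu> n)" for x
  define G where "G x = rE (\<lambda>w. f (x(n := X n w)))" for x
  have near: "\<bar>f (x(n := y)) - f (x'(n := y))\<bar> \<le> L * vnorm n (\<lambda>i. x i - x' i)" for x x' y
    using L(2)[of "x(n := y)" "x'(n := y)"] by (simp only: vnorm_upd)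
  have lipy: "\<bar>f (x(n := y)) - f (x(n := y'))\<bar> \<le> L * \<bar>y - y'\<bar>" for x y y'
    using L(2)[of "x(n := y)" "x(n := y')"] by (simp only: vnorm_upd2)
  have bdy: "bounded (range (\<lambda>y. f (x(n := y))))" for x
    using B unfolding bounded_iff by auto
  have fy: "integrable (\<nu> n) (\<lambda>y. f (x(n := y)))" for x
    using B lip_fun_upd_measurable[OF lf, of x n] measurable_cong_sets[OF sets_eq refl, of n]
    by (intro finite_measure.integrable_const_bound[OF prob_space.finite_measure[OF prob], where B = B]) auto
  have fX: "(\<lambda>w. f (x(n := X n w))) \<in> H" for x
    using lipy by (rule H_lip_real[OF L2_H[OF XL2]])
  have bX: "bounded (range (\<lambda>w. f (x(n := X n w))))" for x
    using B unfolding bounded_iff by auto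
  have finX: "fin (\<lambda>w. f (x(n := X n w)))" for x
    by (intro fin_bounded fX bX)
  have FG: "F x \<le> G x" for x
    unfolding F_def G_def using lipy by (intro dom[where L = L] bdy)
  have lF: "lip n F"
  proof (rule lipI)
    fix x x'
    have "\<bar>F x - F x'\<bar> = \<bar>\<integral>y. f (x(n := y)) - f (x'(n := y)) \<partial>\<nu> n\<bar>"
      using fy by (simp add: F_def)
    also have "\<dots> \<le> (\<integral>y. \<bar>f (x(n := y)) - f (x'(n := y))\<bar> \<partial>\<nu> n)"
      by (rule integral_abs_bound)
    also have "\<dots> \<le> (\<integral>y. L * vnorm n (\<lambda>i. x i - x' i) \<partial>\<nu> n)"
      using fy near by (intro integral_mono) auto
    also have "\<dots> = L * vnorm n (\<lambda>i. x i - x' i)" by (simp add: prob_space.prob_space[OF prob])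
    finally show "\<bar>F x - F x'\<bar> \<le> L * vnorm n (\<lambda>i. x i - x' i)" .
  qed
  have bF: "bounded (range F)"
  proof -
    have "\<bar>F x\<bar> \<le> B" for x
    proof -
      have "\<bar>F x\<bar> \<le> (\<integral>y. \<bar>f (x(n := y))\<bar> \<partial>\<nu> n)"
        unfolding F_def by (rule integral_abs_bound)
      also have "\<dots> \<le> (\<integral>y. B \<partial>\<nu> n)"
        using fy B by (intro integral_mono) auto
      finally show ?thesis by (simp add: prob_space.prob_space[OF prob])
    qed
    then show ?thesis unfolding bounded_iff by auto
  qed
  have Gle: "G x \<le> G x' + L * vnorm n (\<lambda>i. x i - x' i)" for x x'
  proof -
    have "G x \<le> rE (\<lambda>w. f (x'(n := X n w)) + L * vnorm n (\<lambda>i. x i - x' i))"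
      unfolding G_def using near[of x _ x']
      by (intro rE_mono finX fin_add fin_const) (auto simp: abs_le_iff algebra_simps)
    also have "\<dots> \<le> G x' + L * vnorm n (\<lambda>i. x i - x' i)"
      using rE_add[OF finX[of x'] fin_const[of "L * vnorm n (\<lambda>i. x i - x' i)"]]
      by (simp add: G_def rE_const)
    finally show ?thesis .
  qed
  have sym: "vnorm n (\<lambda>i. x i - x' i) = vnorm n (\<lambda>i. x' i - x i)" for x x' :: "nat \<Rightarrow> real"
    by (simp add: vnorm_def power2_commute)
  have lG: "lip n G"
  proof (rule lipI)
    fix x x'
    show "\<bar>G x - G x'\<bar> \<le> L * vnorm n (\<lambda>i. x i - x' i)"
      using Gle[of x x'] Gle[of x' x] sym[of x x'] by (simp add: abs_le_iff)
  qed
  have bG: "bounded (range G)"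
  proof -
    have "\<bar>G x\<bar> \<le> B" for x
    proof -
      have "rE (\<lambda>_. - B) \<le> G x" "G x \<le> rE (\<lambda>_. B)"
        unfolding G_def using B by (auto intro!: rE_mono finX fin_const simp: abs_le_iff minus_le_iff)
      then show ?thesis by (simp add: rE_const abs_le_iff)
    qed
    then show ?thesis unfolding bounded_iff by auto
  qed
  have "integral\<^sup>L (Q (Suc n)) f = integral\<^sup>L (Q n) F"
    unfolding F_def lessThan_Suc
    by (rule PS.product_integral_insert) (use Q_integrable[OF lf bf] in \<open>simp_all add: lessThan_Suc\<close>)
  also have "\<dots> \<le> rE (\<lambda>w. F (path w))"
    using lF bF by (intro Suc.IH) (simp add: bdd_lip_iff)
  also have "\<dots> \<le> rE (\<lambda>w. G (path w))"
    using FG by (intro rE_mono fin_bounded H_path[OF lF] H_path[OF lG] bounded_path bF bG)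
  \<comment> \<open>Independence is phrased with \<open>vecof\<close>, which is 0 from
    \<open>n\<close> on; \<open>G\<close> depends on the coordinates below \<open>n\<close>
    only.\<close>
  also have "\<dots> = rE (\<lambda>w. G (vecof n X w))"
    by (intro arg_cong[of _ _ rE] ext lip_cong[OF lG]) (simp add: vecof_def)
  also have "\<dots> = rE (\<lambda>w. f ((vecof n X w)(n := X n w)))"
    using indep[of n] Suc.prems unfolding indep_of_def G_def rE_def by simp
  also have "\<dots> = rE (\<lambda>w. f (path w))"
    by (intro arg_cong[of _ _ rE] ext lip_cong[OF lf]) (auto simp: vecof_def less_Suc_eq)
  finally show ?case .
qed

lemma Q_coord: 
  assumes "i < n" shows "integrable (Q n) (\<lambda>x. x i)" "integral\<^sup>L (Q n) (\<lambda>x. x i) = \<mu> i"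
proof -
  have d: "distr (Q n) (\<nu> i) (\<lambda>x. x i) = \<nu> i"
    using assms prob by (intro distr_PiM_component) auto
  have m: "(\<lambda>x. x i) \<in> Q n \<rightarrow>\<^sub>M \<nu> i" using assms by simp
  have b: "(\<lambda>y. y) \<in> borel_measurable (\<nu> i)" using int1 by auto
  show "integrable (Q n) (\<lambda>x. x i)"
    using integrable_distr[OF m, of "\<lambda>y. y"] int1[of i] by (simp add: d)
  show "integral\<^sup>L (Q n) (\<lambda>x. x i) = \<mu> i"
    using integral_distr[OF m b] by (simp add: d mean)
qed

text \<open>With \<open>c = 1\<close> and \<open>c = - 1\<close> this supplies the halves of
  additivity that sub-additivity does not. \<open>Q_le_rE\<close> needs bounded functions, so the
  sum is truncated; dominated convergence removes the truncation under the product law and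
  \<open>rE_clip_close\<close> removes it under \<open>rE\<close>.\<close>

lemma mean_sum_le:
  "c * (\<Sum>i<n. \<mu> i) \<le> rE (\<lambda>w. c * (\<Sum>i<n. X i w))"
proof -
  define g where "g x = c * (\<Sum>i<n. x i)" for x :: "nat \<Rightarrow> real"
  have lg: "lip n g" unfolding g_def by (intro lip_mult_const lip_sum lip_coord) auto
  have Ig: "integrable (Q n) g" "integral\<^sup>L (Q n) g = c * (\<Sum>i<n. \<mu> i)"
    unfolding g_def using Q_coord by auto
  have Z: "L2 (\<lambda>w. g (path w))"
  proof -
    have eq: "(\<lambda>w. g (path w)) = (\<lambda>w. \<Sum>i<n. c * X i w)" by (simp add: g_def sum_distrib_left)
    have "L2 (\<lambda>w. c * X i w)" for i
    proof (rule L2I)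
      show "fin (\<lambda>w. (c * X i w)\<^sup>2)"
        unfolding power_mult_distrib by (intro fin_scale L2_fin_square XL2) simp
    qed (intro H_scale L2_H XL2)
    then show ?thesis unfolding eq by (rule L2_sum)
  qed
  have le: "(\<integral>x. clip (real (Suc k)) (g x) \<partial>Q n) \<le> rE (\<lambda>w. g (path w)) + rE (\<lambda>w. (g (path w))\<^sup>2) / real (Suc k)" for k
  proof -
    have "(\<integral>x. clip (real (Suc k)) (g x) \<partial>Q n) \<le> rE (\<lambda>w. clip (real (Suc k)) (g (path w)))"
      by (intro Q_le_rE) (simp add: bdd_lip_iff lip_clip[OF lg] bounded_clip)
    then show ?thesis using rE_clip_close[OF Z, of "real (Suc k)"] by (simp add: abs_le_iff)
  qed
  have lim: "(\<lambda>k. \<integral>x. clip (real (Suc k)) (g x) \<partial>Q n) \<longlonglongrightarrow> integral\<^sup>L (Q n) g"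
  proof (rule integral_dominated_convergence[where w = "\<lambda>x. \<bar>g x\<bar>"])
    show "AE x in Q n. (\<lambda>k. clip (real (Suc k)) (g x)) \<longlonglongrightarrow> g x"
    proof (rule AE_I2, rule tendsto_eventually)
      fix x
      show "eventually (\<lambda>k. clip (real (Suc k)) (g x) = g x) sequentially"
        using eventually_ge_at_top[of "nat \<lceil>\<bar>g x\<bar>\<rceil>"]
      proof eventually_elim
        case (elim k)
        then have "\<bar>g x\<bar> \<le> real k" by linarith
        then show ?case unfolding clip_def by simp
      qed
    qed
    show "AE x in Q n. norm (clip (real (Suc k)) (g x)) \<le> \<bar>g x\<bar>" for k
      by (rule AE_I2) (auto simp: clip_def)
    show "(\<lambda>x. clip (real (Suc k)) (g x)) \<in> borel_measurable (Q n)" for k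
      by (intro lip_measurable_PiM lip_clip lg sets_eq)
  qed (use Ig in auto)
  have "integral\<^sup>L (Q n) g \<le> rE (\<lambda>w. g (path w)) + 0"
  proof (rule LIMSEQ_le[OF lim])
    show "(\<lambda>k. rE (\<lambda>w. g (path w)) + rE (\<lambda>w. (g (path w))\<^sup>2) / real (Suc k)) \<longlonglongrightarrow> rE (\<lambda>w. g (path w)) + 0"
      by (intro tendsto_add tendsto_const LIMSEQ_Suc[OF lim_const_over_n])
  qed (use le in auto)
  then show ?thesis by (simp add: Ig g_def)
qed

end

subsection \<open>The strong law\<close>

text \<open>Without convergence some level \<open>e\<close> is reached at arbitrarily late times,
  hence after every \<open>m j\<close>. Each running maximum then eventually exceeds
  \<open>min 1 e\<close>, and enough of them together exceed \<open>K\<close>.\<close>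

lemma tendsto_0_if_running_max_sum_bounded:
  assumes K: "\<And>n. (\<Sum>j<n. running_max \<mu> a (m j) n x) \<le> K"
    and m: "\<And>j. 1 \<le> m j" and a1: "\<And>n. 1 \<le> n \<Longrightarrow> 1 \<le> a n"
  shows "(\<lambda>n. centered_sum \<mu> n x / a n) \<longlonglongrightarrow> 0"
proof (rule ccontr)
  assume "\<not> ?thesis"
  then obtain e where e: "0 < e" and "\<forall>N. \<exists>k\<ge>N. e \<le> \<bar>centered_sum \<mu> k x / a k\<bar>"
    unfolding LIMSEQ_iff by (auto simp: not_less)
  then have "\<forall>j. \<exists>k\<ge>m j. e \<le> \<bar>centered_sum \<mu> k x / a k\<bar>" by blast
  then obtain k where k: "\<And>j. m j \<le> k j" "\<And>j. e \<le> \<bar>centered_sum \<mu> (k j) x / a (k j)\<bar>" by metis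
  define \<delta> where "\<delta> = min 1 e"
  have d: "0 < \<delta>" using e by (simp add: \<delta>_def)
  obtain J :: nat where J: "K / \<delta> < real J" using reals_Archimedean2 by blast
  \<comment> \<open>A single horizon at least \<open>J\<close>, so that the first \<open>J\<close>
    summands occur, and at least each \<open>k j\<close>, so that their violations are seen.\<close>
  define n where "n = J + (\<Sum>j<J. k j)"
  have "real J * \<delta> = (\<Sum>j<J. \<delta>)" by simp
  also have "\<dots> \<le> (\<Sum>j<J. running_max \<mu> a (m j) n x)"
  proof (rule sum_mono)
    fix j assume j: "j \<in> {..<J}"
    have k1: "1 \<le> k j" using m[of j] k(1)[of j] by simp
    have "k j \<le> (\<Sum>j<J. k j)" using j by (intro member_le_sum[of j "{..<J}" k]) simp_all
    then have kn: "k j \<le> n" by (simp add: n_def)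
    have eq: "\<bar>centered_sum \<mu> (k j) x / a (k j)\<bar> = \<bar>centered_sum \<mu> (k j) x\<bar> / a (k j)"
      using a1[OF k1] by (simp add: abs_divide)
    have "\<delta> \<le> min 1 (\<bar>centered_sum \<mu> (k j) x\<bar> / a (k j))"
      using k(2)[of j] unfolding \<delta>_def eq by (intro min.mono order_refl)
    also have "\<dots> \<le> running_max \<mu> a (m j) n x" by (rule running_max_ge[OF k1 k(1) kn])
    finally show "\<delta> \<le> running_max \<mu> a (m j) n x" .
  qed
  also have "\<dots> \<le> (\<Sum>j<n. running_max \<mu> a (m j) n x)"
    by (intro sum_mono2) (auto simp: n_def running_max_nonneg)
  also have "\<dots> \<le> K" by (rule K)
  finally show False using J d by (simp add: field_simps)
qed

context cc_seq
begin

lemma strong_law: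
  assumes inf: "filterlim a at_top sequentially"
    and sm: "summable (\<lambda>i. s i / (a (Suc i))\<^sup>2)"
  shows "\<exists>P\<in>Ps. AE w in P. (\<lambda>n. centered_sum \<mu> n (path w) / a n) \<longlonglongrightarrow> 0"
proof -
  have "\<exists>m\<ge>1. \<forall>n. integral\<^sup>L (Q n) (running_max \<mu> a m n) \<le> (1/2) ^ j" for j
  proof -
    \<comment> \<open>Chosen so that the bound \<open>2 * e\<close> from
      \<open>running_max_integral\<close> is the j-th term of a geometric series.\<close>
    define e :: real where "e = (1/2) ^ j / 2"
    have e: "0 < e" by (simp add: e_def)
    obtain m where m: "1 \<le> m" "\<And>n. m \<le> n \<Longrightarrow> (\<Sum>i<m. s i) / (a m)\<^sup>2 + (\<Sum>i=m..<n. s i / (a (Suc i))\<^sup>2) \<le> e ^ 3"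
      using kronecker_tail[OF s_nonneg a_ge1 a_mono inf sm, of "e ^ 3"] e by auto
    have "integral\<^sup>L (Q n) (running_max \<mu> a m n) \<le> 2 * e" for n
    proof (cases "m \<le> n")
      case True
      then show ?thesis using running_max_integral[OF m(1) _ e m(2)] by simp
    next
      case False
      then have "running_max \<mu> a m n = (\<lambda>_. 0)" by (auto simp: running_max_eq_0)
      then show ?thesis using e by simp
    qed
    then show ?thesis using m(1) by (auto simp: e_def)
  qed
  then obtain m where m: "\<And>j. 1 \<le> m j" "\<And>j n. integral\<^sup>L (Q n) (running_max \<mu> a (m j) n) \<le> (1/2) ^ j"
    by metis
  define \<Psi> where "\<Psi> n x = (\<Sum>j<n. running_max \<mu> a (m j) n x)" for n :: nat and x
  have l\<Psi>: "lip n (\<Psi> n)" for n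
    unfolding \<Psi>_def by (intro lip_sum lip_running_max order_refl)
  have \<Psi>0: "0 \<le> \<Psi> n x" for n x
    unfolding \<Psi>_def by (intro sum_nonneg running_max_nonneg)
  have b\<Psi>: "bounded (range (\<Psi> n))" for n
  proof -
    have "\<Psi> n x \<le> (\<Sum>j<n. 1)" for x
      unfolding \<Psi>_def by (intro sum_mono running_max_le_1)
    then show ?thesis
      using \<Psi>0[of n] unfolding bounded_iff by (auto intro!: exI[of _ "real n"])
  qed
  have i\<Psi>: "integral\<^sup>L (Q n) (\<Psi> n) \<le> 2" for n
  proof -
    have "integrable (Q n) (running_max \<mu> a (m j) n)" for j
      using running_max_nonneg[of \<mu> a] running_max_le_1[of \<mu> a] unfolding bounded_iff
      by (intro Q_integrable lip_running_max order_refl) (auto simp: bounded_iff intro!: exI[of _ 1])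
    then have "integral\<^sup>L (Q n) (\<Psi> n) = (\<Sum>j<n. integral\<^sup>L (Q n) (running_max \<mu> a (m j) n))"
      unfolding \<Psi>_def by (intro Bochner_Integration.integral_sum)
    also have "\<dots> \<le> (\<Sum>j<n. (1/2) ^ j)"
      by (intro sum_mono m(2))
    also have "\<dots> \<le> 2"
      by (simp add: sum_gp_strict)
    finally show ?thesis .
  qed
  \<comment> \<open>The product law itself need not be realised in \<open>Ps\<close>. Packing all scales into the single
    functional \<open>\<Psi>\<close> turns almost sure convergence into one expectation bound, which some member of
    \<open>Ps\<close> nearly shares for each \<open>n\<close> and which survives the weak limit.\<close>
  define Z where "Z n = (\<lambda>w. \<Psi> n (path w))" for n
  have Z: "Z n \<in> H" "bounded (range (Z n))" for n
    unfolding Z_def by (rule H_path[OF l\<Psi>], rule bounded_path[OF b\<Psi>])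
  have Zm: "(\<lambda>w. - Z n w) \<in> H" "bounded (range (\<lambda>w. - Z n w))" for n
    using Z[of n] by (auto intro: H_uminus simp: bounded_iff)
  have "\<exists>P. P \<in> Ps \<and> integral\<^sup>L P (Z n) \<le> 3" for n
  proof -
    have l: "lip n (\<lambda>x. - \<Psi> n x)" using lip_mult_const[OF l\<Psi>[of n], of "-1"] by simp
    have b: "bounded (range (\<lambda>x. - \<Psi> n x))" using b\<Psi>[of n] by (simp add: bounded_iff)
    \<comment> \<open>The sign matters: approximating the supremum for \<open>- Z n\<close> within 1
      yields one measure under which \<open>Z n\<close> has integral at most 2 + 1.\<close>
    have "- 2 \<le> rE (\<lambda>w. - Z n w)"
      using Q_le_rE[of n "\<lambda>x. - \<Psi> n x"] l b i\<Psi>[of n] by (simp add: bdd_lip_iff Z_def)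
    then obtain P where P: "P \<in> Ps" "- 3 < integral\<^sup>L P (\<lambda>w. - Z n w)"
      using rE_approx[OF Zm, of 1 n] by force
    then show ?thesis by auto
  qed
  then obtain Pn where Pn: "\<And>n. Pn n \<in> Ps" "\<And>n. integral\<^sup>L (Pn n) (Z n) \<le> 3" by metis
  have Zmono: "Z n w \<le> Z n' w" if "n \<le> n'" for n n' w
  proof -
    have "Z n w \<le> (\<Sum>j<n. running_max \<mu> a (m j) n' (path w))"
      unfolding Z_def \<Psi>_def using that by (intro sum_mono running_max_mono)
    also have "\<dots> \<le> Z n' w"
      unfolding Z_def \<Psi>_def using that by (intro sum_mono2) (auto simp: running_max_nonneg)
    finally show ?thesis .
  qed
  obtain r P where r: "strict_mono r" and P: "P \<in> Ps" and
    lim: "\<And>i. (\<lambda>k. integral\<^sup>L (Pn (r k)) (Z i)) \<longlonglongrightarrow> integral\<^sup>L P (Z i)"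
    using compactness[of Z Pn] Z Pn(1) by metis
  \<comment> \<open>\<open>Pn (r k)\<close> controls only \<open>Z (r k)\<close> directly; as
    \<open>Z\<close> increases with its index, it controls \<open>Z i\<close> as well once
    \<open>r k\<close> has passed \<open>i\<close>.\<close>
  have Z3: "integral\<^sup>L P (Z i) \<le> 3" for i
  proof (rule LIMSEQ_le_const2[OF lim], intro exI[of _ i] allI impI)
    fix k assume "i \<le> k"
    then have "i \<le> r k" using seq_suble[OF r, of k] by simp
    then have "integral\<^sup>L (Pn (r k)) (Z i) \<le> integral\<^sup>L (Pn (r k)) (Z (r k))"
      by (intro integral_mono P_integrable_bounded Pn(1) Z Zmono)
    then show "integral\<^sup>L (Pn (r k)) (Z i) \<le> 3" using Pn(2)[of "r k"] by simp
  qed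
  have meas: "(\<lambda>w. ennreal (Z i w)) \<in> borel_measurable P" for i
    using H_measurable[OF P Z(1)] by measurable
  have "(\<integral>\<^sup>+w. (SUP i. ennreal (Z i w)) \<partial>P) = (SUP i. \<integral>\<^sup>+w. ennreal (Z i w) \<partial>P)"
    using Zmono by (intro nn_integral_monotone_convergence_SUP meas)
      (auto simp: incseq_def le_fun_def intro: ennreal_leI)
  also have "\<dots> \<le> ennreal 3"
  proof (rule SUP_least)
    fix i
    have "(\<integral>\<^sup>+w. ennreal (Z i w) \<partial>P) = ennreal (integral\<^sup>L P (Z i))"
      using P_integrable_bounded[OF P Z, of i] \<Psi>0 by (simp add: nn_integral_eq_integral Z_def)
    then show "(\<integral>\<^sup>+w. ennreal (Z i w) \<partial>P) \<le> ennreal 3"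
      by (metis Z3 ennreal_leI)
  qed
  finally have fin: "(\<integral>\<^sup>+w. (SUP i. ennreal (Z i w)) \<partial>P) \<noteq> \<infinity>"
    using ennreal_less_top[of 3] by (auto simp: top_unique)
  have "AE w in P. (SUP i. ennreal (Z i w)) \<noteq> \<infinity>"
    by (rule nn_integral_noteq_infinite[OF borel_measurable_SUP[OF _ meas] fin]) simp
  then have "AE w in P. (\<lambda>n. centered_sum \<mu> n (path w) / a n) \<longlonglongrightarrow> 0"
  proof eventually_elim
    case (elim w)
    then obtain K where K: "0 \<le> K" "(SUP i. ennreal (Z i w)) = ennreal K"
      by (cases "SUP i. ennreal (Z i w)") auto
    show ?case
    proof (rule tendsto_0_if_running_max_sum_bounded[OF _ m(1) a_ge1])
      fix n
      have "ennreal (Z n w) \<le> ennreal K"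
        unfolding K(2)[symmetric] by (intro SUP_upper) simp
      then show "(\<Sum>j<n. running_max \<mu> a (m j) n (path w)) \<le> K"
        using K(1) by (simp add: Z_def \<Psi>_def)
    qed
  qed
  then show ?thesis using P by blast
qed

end

text \<open>Upper means on even blocks, lower means on odd ones. At the end of an even block the
  deficit from the upper means stems from earlier blocks only, and the block is long enough for
  \<open>a\<close> to dwarf it; odd blocks do the same for the lower means. So \<open>p\<close>
  lists ends of even blocks and \<open>q\<close> ends of odd ones.\<close>

lemma alternating_selection:
  fixes l u a :: "nat \<Rightarrow> real"
  assumes lu: "\<And>i. l i \<le> u i" and inf: "filterlim a at_top sequentially"
  shows "\<exists>\<mu> p q. (\<forall>i. l i \<le> \<mu> i \<and> \<mu> i \<le> u i) \<and> strict_mono p \<and> strict_mono q \<and>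
    (\<lambda>k. (\<Sum>i<p k. u i - \<mu> i) / a (p k)) \<longlonglongrightarrow> 0 \<and>
    (\<lambda>k. (\<Sum>i<q k. \<mu> i - l i) / a (q k)) \<longlonglongrightarrow> 0"
proof -
  define G where "G n = (\<Sum>i<n. u i - l i)" for n
  \<comment> \<open>\<open>True\<close> is the trivial invariant in the pattern of
    \<open>dependent_nat_choice\<close>. The factor \<open>Suc k\<close> makes the earlier gap,
    relative to \<open>a\<close>, at most \<open>1 / Suc k\<close> at the end of block
    \<open>k\<close>.\<close>
  have "\<exists>N. \<forall>k. True \<and> (N k < N (Suc k) \<and> 0 < a (N (Suc k)) \<and> real (Suc k) * G (N k) \<le> a (N (Suc k)))"
  proof (rule dependent_nat_choice)
    fix x k :: nat
    have "eventually (\<lambda>y. max 1 (real (Suc k) * G x) \<le> a y) sequentially"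
      using inf unfolding filterlim_at_top by blast
    then have "eventually (\<lambda>y. max 1 (real (Suc k) * G x) \<le> a y \<and> x < y) sequentially"
      using eventually_gt_at_top[of x] by (rule eventually_conj)
    then obtain y where "max 1 (real (Suc k) * G x) \<le> a y" "x < y"
      using eventually_happens trivial_limit_sequentially by blast
    then show "\<exists>y. True \<and> (x < y \<and> 0 < a y \<and> real (Suc k) * G x \<le> a y)" by auto
  qed simp
  then obtain N where N: "\<And>k. N k < N (Suc k)" "\<And>k. 0 < a (N (Suc k))"
    "\<And>k. real (Suc k) * G (N k) \<le> a (N (Suc k))" by blast
  have mono: "strict_mono N" using N(1) by (rule strict_mono_Suc_iff[THEN iffD2, OF allI])
  define \<mu> where "\<mu> i = (if \<exists>k. even k \<and> N k \<le> i \<and> i < N (Suc k) then u i else l i)" for i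
  have mu: "l i \<le> \<mu> i" "\<mu> i \<le> u i" for i using lu by (auto simp: \<mu>_def)
  have even: "\<mu> i = u i" if "even k" "N k \<le> i" "i < N (Suc k)" for i k
    using that by (auto simp: \<mu>_def)
  have odd: "\<mu> i = l i" if "odd k" "N k \<le> i" "i < N (Suc k)" for i k
  proof -
    have "\<not> (N k' \<le> i \<and> i < N (Suc k'))" if "even k'" for k'
    proof
      assume k': "N k' \<le> i \<and> i < N (Suc k')"
      have "k' \<noteq> k" using that \<open>odd k\<close> by auto
      then consider "Suc k' \<le> k" | "Suc k \<le> k'" by linarith
      then show False
      proof cases
        case 1
        then have "N (Suc k') \<le> N k" using mono by (simp add: strict_mono_less_eq)
        then show ?thesis using k' \<open>N k \<le> i\<close> by simp
      next
        case 2
        then have "N (Suc k) \<le> N k'" using mono by (simp add: strict_mono_less_eq)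
        then show ?thesis using k' \<open>i < N (Suc k)\<close> by simp
      qed
    qed
    then show ?thesis by (auto simp: \<mu>_def)
  qed
  \<comment> \<open>Here \<open>f\<close> stands for either gap, upper mean minus \<mu> or \<mu>
    minus lower mean, whichever vanishes on block \<open>k\<close>.\<close>
  have small: "(\<Sum>i<N (Suc k). f i) / a (N (Suc k)) \<le> 1 / real (Suc k)"
    if z: "\<And>i. N k \<le> i \<Longrightarrow> i < N (Suc k) \<Longrightarrow> f i = 0" and f: "\<And>i. f i \<le> u i - l i" for f k
  proof -
    have "(\<Sum>i<N (Suc k). f i) = (\<Sum>i<N k. f i)"
      using N(1)[of k] z by (intro sum.mono_neutral_right) (auto simp: not_less)
    also have "\<dots> \<le> G (N k)" unfolding G_def by (intro sum_mono f)
    finally have "real (Suc k) * (\<Sum>i<N (Suc k). f i) \<le> a (N (Suc k))"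
      using N(3)[of k] mult_left_mono[of "\<Sum>i<N (Suc k). f i" "G (N k)" "real (Suc k)"] by linarith
    then show ?thesis using N(2)[of k] by (simp add: field_simps)
  qed
  have lim: "(\<lambda>k. (\<Sum>i<N (Suc (g k)). f i) / a (N (Suc (g k)))) \<longlonglongrightarrow> 0"
    if g: "strict_mono g" and z: "\<And>k i. N (g k) \<le> i \<Longrightarrow> i < N (Suc (g k)) \<Longrightarrow> f i = 0"
      and f: "\<And>i. 0 \<le> f i" "\<And>i. f i \<le> u i - l i" for f :: "nat \<Rightarrow> real" and g :: "nat \<Rightarrow> nat"
  proof (rule tendsto_sandwich[OF _ _ tendsto_const])
    show "eventually (\<lambda>k. 0 \<le> (\<Sum>i<N (Suc (g k)). f i) / a (N (Suc (g k)))) sequentially"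
      using f(1) N(2) by (intro always_eventually allI divide_nonneg_nonneg sum_nonneg) (auto intro: less_imp_le)
    show "eventually (\<lambda>k. (\<Sum>i<N (Suc (g k)). f i) / a (N (Suc (g k))) \<le> 1 / real (Suc (g k))) sequentially"
      using z f(2) by (intro always_eventually allI small)
    show "(\<lambda>k. 1 / real (Suc (g k))) \<longlonglongrightarrow> 0"
      using LIMSEQ_subseq_LIMSEQ[OF LIMSEQ_Suc[OF lim_const_over_n[of 1]] g] by (simp add: comp_def)
  qed
  show ?thesis
  proof (intro exI conjI allI mu)
    show "strict_mono (\<lambda>k. N (Suc (2 * k)))"
      using mono by (auto simp: strict_mono_def)
    show "strict_mono (\<lambda>k. N (Suc (Suc (2 * k))))"
      using mono by (auto simp: strict_mono_def)
    show "(\<lambda>k. (\<Sum>i<N (Suc (2 * k)). u i - \<mu> i) / a (N (Suc (2 * k)))) \<longlonglongrightarrow> 0"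
    proof (rule lim[of "\<lambda>k. 2 * k"])
      show "u i - \<mu> i = 0" if "N (2 * k) \<le> i" "i < N (Suc (2 * k))" for k i
        using even[OF _ that] by simp
    qed (use mu in \<open>auto simp: strict_mono_def\<close>)
    show "(\<lambda>k. (\<Sum>i<N (Suc (Suc (2 * k))). \<mu> i - l i) / a (N (Suc (Suc (2 * k))))) \<longlonglongrightarrow> 0"
    proof (rule lim[of "\<lambda>k. Suc (2 * k)"])
      show "\<mu> i - l i = 0" if "N (Suc (2 * k)) \<le> i" "i < N (Suc (Suc (2 * k)))" for k i
        using odd[OF _ that] by simp
    qed (use mu in \<open>auto simp: strict_mono_def\<close>)
  qed (rule mu)+
qed

text \<open>Meant for \<open>t\<close> the sums centred at the alternating means and
  \<open>d\<close> their deficit from the upper means: subtracting \<open>d\<close> cannot raise the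
  upper limit, and along \<open>p\<close> it costs nothing.\<close>

lemma limsup_diff_eq_0:
  fixes t d :: "nat \<Rightarrow> real"
  assumes t: "t \<longlonglongrightarrow> 0" and d: "\<And>n. 0 \<le> d n" and p: "strict_mono p" "(\<lambda>k. d (p k)) \<longlonglongrightarrow> 0"
  shows "limsup (\<lambda>n. ereal (t n - d n)) = 0"
proof (rule antisym)
  have "limsup (\<lambda>n. ereal (t n - d n)) \<le> limsup (\<lambda>n. ereal (t n))"
    using d by (intro Limsup_mono always_eventually) auto
  also have "\<dots> = 0"
    using lim_imp_Limsup[OF trivial_limit_sequentially tendsto_ereal[OF t]] by (simp add: zero_ereal_def)
  finally show "limsup (\<lambda>n. ereal (t n - d n)) \<le> 0" .
  have "(\<lambda>k. t (p k) - d (p k)) \<longlonglongrightarrow> 0 - 0"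
    using LIMSEQ_subseq_LIMSEQ[OF t p(1)] p(2) by (intro tendsto_diff) (simp_all add: comp_def)
  then have lim: "(\<lambda>k. ereal (t (p k) - d (p k))) \<longlonglongrightarrow> ereal 0"
    by (intro tendsto_ereal) simp
  then have "limsup ((\<lambda>n. ereal (t n - d n)) \<circ> p) = 0"
    using lim_imp_Limsup[OF trivial_limit_sequentially lim] by (simp add: comp_def zero_ereal_def)
  then show "0 \<le> limsup (\<lambda>n. ereal (t n - d n))"
    using limsup_subseq_mono[OF p(1), of "\<lambda>n. ereal (t n - d n)"] by simp
qed

lemma liminf_add_eq_0:
  fixes t d :: "nat \<Rightarrow> real"
  assumes t: "t \<longlonglongrightarrow> 0" and d: "\<And>n. 0 \<le> d n" and p: "strict_mono p" "(\<lambda>k. d (p k)) \<longlonglongrightarrow> 0"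
  shows "liminf (\<lambda>n. ereal (t n + d n)) = 0"
proof -
  have "limsup (\<lambda>n. ereal (- t n - d n)) = 0"
    using tendsto_minus[OF t] by (intro limsup_diff_eq_0[OF _ d p]) simp
  moreover have "(\<lambda>n. ereal (- t n - d n)) = (\<lambda>n. - ereal (t n + d n))" by auto
  ultimately have "limsup (\<lambda>n. - ereal (t n + d n)) = 0" by (simp only:)
  then have "- liminf (\<lambda>n. ereal (t n + d n)) = 0"
    unfolding ereal_Limsup_uminus .
  then show ?thesis by (simp only: ereal_uminus_zero_iff)
qed

section \<open>Passage to the given sequence\<close>

context cc_space
begin

text \<open>With no earlier variables the inner expectation is a constant, and a finite one, so that
  \<open>real_of_ereal\<close> loses nothing and \<open>E\<close> preserves it.
  \<open>indep_seq\<close> starts at 1, while the induction over product laws starts at 0.\<close>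

lemma indep_of_0:
  assumes "Y \<in> H" shows "indep_of E 0 X Y"
  unfolding indep_of_def
proof (intro allI impI)
  fix \<phi> :: "(nat \<Rightarrow> real) \<Rightarrow> real" assume "bdd_lip (Suc 0) \<phi>"
  then have l: "lip (Suc 0) \<phi>" and b: "bounded (range \<phi>)" by (auto simp: bdd_lip_iff)
  define Z where "Z = (\<lambda>w. \<phi> ((\<lambda>_. 0)(0 := Y w)))"
  have "(\<lambda>w. \<phi> (\<lambda>_. Y w)) \<in> H" using H_lip[of "Suc 0" "\<lambda>_. Y" \<phi>] assms l by simp
  moreover have "\<phi> (\<lambda>_. Y w) = Z w" for w
    unfolding Z_def by (rule lip_cong[OF l]) simp
  ultimately have "Z \<in> H" by simp
  moreover have "bounded (range Z)"
    using b by (rule bounded_subset) (auto simp: Z_def)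
  ultimately have "E Z = ereal (rE Z)" by (intro E_eq_rE fin_bounded)
  then show "E (\<lambda>w. \<phi> ((vecof 0 X w)(0 := Y w))) =
      E (\<lambda>w. real_of_ereal (E (\<lambda>w'. \<phi> ((vecof 0 X w)(0 := Y w')))))"
    by (simp add: vecof_def E_const Z_def rE_def)
qed

lemma strong_law_and_means:
  fixes Y :: "nat \<Rightarrow> 'a \<Rightarrow> real" and a \<mu> :: "nat \<Rightarrow> real"
  assumes Y: "\<And>i. L2 (Y i)" and ind: "\<And>n. indep_of E n Y (Y n)"
    and a1: "\<And>n. 1 \<le> n \<Longrightarrow> 1 \<le> a n" and am: "\<And>n. 1 \<le> n \<Longrightarrow> a n \<le> a (Suc n)"
    and mu: "\<And>i. - rE (\<lambda>w. - Y i w) \<le> \<mu> i" "\<And>i. \<mu> i \<le> rE (Y i)"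
  shows "c * (\<Sum>i<n. \<mu> i) \<le> rE (\<lambda>w. c * (\<Sum>i<n. Y i w))"
    and "filterlim a at_top sequentially \<Longrightarrow>
      summable (\<lambda>i. rE (\<lambda>w. (Y i w)\<^sup>2) / (a (Suc i))\<^sup>2) \<Longrightarrow>
      \<exists>P\<in>Ps. AE w in P. (\<lambda>n. centered_sum \<mu> n (\<lambda>i. Y i w) / a n) \<longlonglongrightarrow> 0"
proof -
  obtain \<nu> where nu: "\<And>i. prob_space (\<nu> i) \<and> sets (\<nu> i) = sets borel \<and>
    integrable (\<nu> i) (\<lambda>y. y) \<and> integrable (\<nu> i) (\<lambda>y. y\<^sup>2) \<and> integral\<^sup>L (\<nu> i) (\<lambda>y. y) = \<mu> i \<and>
    integral\<^sup>L (\<nu> i) (\<lambda>y. y\<^sup>2) \<le> rE (\<lambda>w. (Y i w)\<^sup>2) \<and>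
    (\<forall>f L. (\<forall>x y. \<bar>f x - f y\<bar> \<le> L * \<bar>x - y\<bar>) \<longrightarrow> bounded (range f) \<longrightarrow>
      integral\<^sup>L (\<nu> i) f \<le> rE (\<lambda>w. f (Y i w)))"
    using dominated_law[OF Y mu] by metis
  interpret cc_seq H E Ps \<nu> \<mu> "\<lambda>i. rE (\<lambda>w. (Y i w)\<^sup>2)" a Y
  proof (intro cc_seq.intro cc_space_axioms marginals.intro cc_seq_axioms.intro)
    show "integral\<^sup>L (\<nu> i) f \<le> rE (\<lambda>w. f (Y i w))"
      if "\<And>x y. \<bar>f x - f y\<bar> \<le> L * \<bar>x - y\<bar>" "bounded (range f)" for i f L
      using nu[of i] that by metis
  qed (simp_all add: nu a1 am Y ind)
  show "c * (\<Sum>i<n. \<mu> i) \<le> rE (\<lambda>w. c * (\<Sum>i<n. Y i w))" by (rule mean_sum_le)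
  show "\<exists>P\<in>Ps. AE w in P. (\<lambda>n. centered_sum \<mu> n (\<lambda>i. Y i w) / a n) \<longlonglongrightarrow> 0"
    if "filterlim a at_top sequentially" "summable (\<lambda>i. rE (\<lambda>w. (Y i w)\<^sup>2) / (a (Suc i))\<^sup>2)"
    using that by (rule strong_law)
qed

end

theorem theorem3p2:
  fixes H :: "('a \<Rightarrow> real) set"
    and E :: "('a \<Rightarrow> real) \<Rightarrow> ereal"
    and Ps :: "'a measure set"
    and X :: "nat \<Rightarrow> 'a \<Rightarrow> real"
    and a :: "nat \<Rightarrow> real"
  assumes sle: "sublinear_expectation_space H E"
    and CC: "condition_CC H E Ps"
    and XH: "\<forall>n\<ge>1. X n \<in> H"
    and indep: "indep_seq E X"
    and a_ge1: "\<forall>n\<ge>1. 1 \<le> a n"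
    and a_mono: "\<forall>n\<ge>1. a n \<le> a (Suc n)"
    and a_inf: "filterlim a at_top sequentially"
    and fin2: "\<forall>n\<ge>1. E (\<lambda>w. (X n w)^2) < \<infinity>"
    and summ: "summable (\<lambda>n. real_of_ereal (E (\<lambda>w. (X (Suc n) w)^2)) / (a (Suc n))^2)"
  shows "(\<exists>P\<in>Ps. emeasure P {w \<in> space P.
            limsup (\<lambda>n. ereal (((\<Sum>i=1..n. X i w) - real_of_ereal (E (\<lambda>v. \<Sum>i=1..n. X i v))) / a n)) = 0 \<and>
            liminf (\<lambda>n. ereal (((\<Sum>i=1..n. X i w) - real_of_ereal (Ehat E (\<lambda>v. \<Sum>i=1..n. X i v))) / a n)) = 0} = 1)
       \<and> (\<forall>\<mu> :: nat \<Rightarrow> real. (\<forall>n\<ge>1. Ehat E (X n) \<le> ereal (\<mu> n) \<and> ereal (\<mu> n) \<le> E (X n)) \<longrightarrow>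
            (\<exists>P\<in>Ps. emeasure P {w \<in> space P.
               (\<lambda>n. (\<Sum>i=1..n. X i w - \<mu> i) / a n) \<longlonglongrightarrow> 0} = 1))"
proof -
  interpret cc_space H E Ps using sle CC by unfold_locales
  define Y where "Y i = X (Suc i)" for i
  have Y: "L2 (Y i)" for i using XH fin2 by (simp add: L2_def Y_def)
  have YH: "Y i \<in> H" for i by (rule L2_H[OF Y])
  have ind: "indep_of E n Y (Y n)" for n
  proof (cases n)
    case 0
    then show ?thesis using indep_of_0[OF YH] by simp
  next
    case (Suc k)
    then show ?thesis using indep[unfolded indep_seq_def, rule_format, of n] by (simp add: Y_def[abs_def])
  qed
  have sm: "summable (\<lambda>i. rE (\<lambda>w. (Y i w)\<^sup>2) / (a (Suc i))\<^sup>2)"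
    using summ by (simp add: rE_def Y_def)
  have S: "(\<Sum>i=1..n. f i) = (\<Sum>i<n. f (Suc i))" for f :: "nat \<Rightarrow> real" and n
    by (simp add: sum.atLeast1_atMost_eq)
  define u where "u i = rE (Y i)" for i
  define l where "l i = - rE (\<lambda>w. - Y i w)" for i
  have law: "\<exists>P\<in>Ps. AE w in P. (\<lambda>n. centered_sum \<mu> n (\<lambda>i. Y i w) / a n) \<longlonglongrightarrow> 0"
    if "\<And>i. l i \<le> \<mu> i" "\<And>i. \<mu> i \<le> u i" for \<mu>
    using that a_ge1 a_mono by (intro strong_law_and_means(2)[OF Y ind _ _ _ _ a_inf sm]) (auto simp: l_def u_def)
  have lu: "l i \<le> u i" for i
    using rE_add[OF L2_fin[OF Y] L2_fin[OF L2_uminus[OF Y]], of i i] by (simp add: l_def u_def rE_const)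
  have fS: "fin (\<lambda>w. \<Sum>i<n. Y i w)" for n by (intro fin_sum L2_fin Y)
  have ES: "rE (\<lambda>w. \<Sum>i<n. Y i w) = (\<Sum>i<n. u i)" for n
  proof (rule antisym)
    show "rE (\<lambda>w. \<Sum>i<n. Y i w) \<le> (\<Sum>i<n. u i)"
      unfolding u_def by (intro rE_sum L2_fin Y) simp
    \<comment> \<open>The half not given by sub-additivity: a product law whose marginals all have
      the upper means.\<close>
    have "1 * (\<Sum>i<n. u i) \<le> rE (\<lambda>w. 1 * (\<Sum>i<n. Y i w))"
      using lu a_ge1 a_mono
      by (intro strong_law_and_means(1)[OF Y ind, of a]) (auto simp: l_def u_def)
    then show "(\<Sum>i<n. u i) \<le> rE (\<lambda>w. \<Sum>i<n. Y i w)" by simp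
  qed
  have ES': "rE (\<lambda>w. - (\<Sum>i<n. Y i w)) = - (\<Sum>i<n. l i)" for n
  proof (rule antisym)
    have "rE (\<lambda>w. \<Sum>i<n. - Y i w) \<le> (\<Sum>i<n. rE (\<lambda>w. - Y i w))"
      by (intro rE_sum L2_fin L2_uminus Y) simp
    then show "rE (\<lambda>w. - (\<Sum>i<n. Y i w)) \<le> - (\<Sum>i<n. l i)"
      by (simp add: sum_negf l_def)
    \<comment> \<open>The same with all marginals at the lower means and the sum negated.\<close>
    have "- 1 * (\<Sum>i<n. l i) \<le> rE (\<lambda>w. - 1 * (\<Sum>i<n. Y i w))"
      using lu a_ge1 a_mono
      by (intro strong_law_and_means(1)[OF Y ind, of a]) (auto simp: l_def u_def)
    then show "- (\<Sum>i<n. l i) \<le> rE (\<lambda>w. - (\<Sum>i<n. Y i w))" by simp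
  qed
  have E1: "real_of_ereal (E (\<lambda>v. \<Sum>i=1..n. X i v)) = (\<Sum>i<n. u i)" for n
    unfolding S using ES[of n] by (simp add: rE_def Y_def)
  have E2: "real_of_ereal (Ehat E (\<lambda>v. \<Sum>i=1..n. X i v)) = (\<Sum>i<n. l i)" for n
    unfolding S Ehat_def using ES'[of n] by (simp add: rE_def Y_def)
  have Ym: "Y i \<in> borel_measurable P" if "P \<in> Ps" for P i
    by (rule H_measurable[OF that YH])
  have apos: "0 < a n" if "1 \<le> n" for n using a_ge1 that by force
  obtain \<mu> p q where mu: "\<And>i. l i \<le> \<mu> i" "\<And>i. \<mu> i \<le> u i" and p: "strict_mono p" and q: "strict_mono q"
    and pl: "(\<lambda>k. (\<Sum>i<p k. u i - \<mu> i) / a (p k)) \<longlonglongrightarrow> 0"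
    and ql: "(\<lambda>k. (\<Sum>i<q k. \<mu> i - l i) / a (q k)) \<longlonglongrightarrow> 0"
    using alternating_selection[of l u a, OF lu a_inf] by blast
  have nonneg: "0 \<le> (\<Sum>i<n. f i) / a n" if "\<And>i. 0 \<le> f i" for f :: "nat \<Rightarrow> real" and n
    \<comment> \<open>The sign of \<open>a 0\<close> is unknown, but at \<open>n = 0\<close> the sum
      is empty.\<close>
    using that apos[of n] by (cases n) (auto intro!: divide_nonneg_nonneg sum_nonneg simp del: sum.lessThan_Suc)
  obtain P where P: "P \<in> Ps" "AE w in P. (\<lambda>n. centered_sum \<mu> n (\<lambda>i. Y i w) / a n) \<longlonglongrightarrow> 0"
    using law[OF mu] by blast
  note [measurable] = Ym[OF P(1)]
  have part1: "emeasure P {w \<in> space P.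
      limsup (\<lambda>n. ereal (((\<Sum>i=1..n. X i w) - real_of_ereal (E (\<lambda>v. \<Sum>i=1..n. X i v))) / a n)) = 0 \<and>
      liminf (\<lambda>n. ereal (((\<Sum>i=1..n. X i w) - real_of_ereal (Ehat E (\<lambda>v. \<Sum>i=1..n. X i v))) / a n)) = 0} = 1"
    unfolding E1 E2 unfolding S Y_def[symmetric]
  proof (rule prob_space.emeasure_eq_1_AE[OF P_prob[OF P(1)]])
    show "{w \<in> space P. limsup (\<lambda>n. ereal (((\<Sum>i<n. Y i w) - (\<Sum>i<n. u i)) / a n)) = 0 \<and>
        liminf (\<lambda>n. ereal (((\<Sum>i<n. Y i w) - (\<Sum>i<n. l i)) / a n)) = 0} \<in> sets P"
      by measurable
    show "AE w in P. w \<in> {w \<in> space P. limsup (\<lambda>n. ereal (((\<Sum>i<n. Y i w) - (\<Sum>i<n. u i)) / a n)) = 0 \<and>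
        liminf (\<lambda>n. ereal (((\<Sum>i<n. Y i w) - (\<Sum>i<n. l i)) / a n)) = 0}"
      using P(2) AE_space
    proof eventually_elim
      case (elim w)
      \<comment> \<open>Both centrings of part (i) are expressed through the one sequence centred at
        \<mu>, which tends to 0, minus or plus a non-negative gap that vanishes along
        \<open>p\<close> or \<open>q\<close>.\<close>
      have "((\<Sum>i<n. Y i w) - (\<Sum>i<n. u i)) / a n = centered_sum \<mu> n (\<lambda>i. Y i w) / a n - (\<Sum>i<n. u i - \<mu> i) / a n" for n
        by (simp add: centered_sum_def sum_subtractf diff_divide_distrib)
      moreover have "((\<Sum>i<n. Y i w) - (\<Sum>i<n. l i)) / a n = centered_sum \<mu> n (\<lambda>i. Y i w) / a n + (\<Sum>i<n. \<mu> i - l i) / a n" for n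
        by (simp add: centered_sum_def sum_subtractf diff_divide_distrib)
      ultimately show ?case
        using elim limsup_diff_eq_0[OF elim(1) nonneg p pl] liminf_add_eq_0[OF elim(1) nonneg q ql] mu by simp
    qed
  qed
  have part2: "\<exists>P\<in>Ps. emeasure P {w \<in> space P. (\<lambda>n. (\<Sum>i=1..n. X i w - \<mu> i) / a n) \<longlonglongrightarrow> 0} = 1"
    if mu: "\<forall>n\<ge>1. Ehat E (X n) \<le> ereal (\<mu> n) \<and> ereal (\<mu> n) \<le> E (X n)" for \<mu>
  proof -
    have "l i \<le> \<mu> (Suc i)" "\<mu> (Suc i) \<le> u i" for i
      using mu[rule_format, of "Suc i"] E_eq_rE[OF L2_fin[OF Y], of i] E_eq_rE[OF L2_fin[OF L2_uminus[OF Y]], of i]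
      by (simp_all add: Ehat_def l_def u_def Y_def)
    then obtain P where P: "P \<in> Ps" "AE w in P. (\<lambda>n. centered_sum (\<lambda>i. \<mu> (Suc i)) n (\<lambda>i. Y i w) / a n) \<longlonglongrightarrow> 0"
      using law[of "\<lambda>i. \<mu> (Suc i)"] by blast
    note [measurable] = Ym[OF P(1)]
    have "emeasure P {w \<in> space P. (\<lambda>n. (\<Sum>i<n. Y i w - \<mu> (Suc i)) / a n) \<longlonglongrightarrow> 0} = 1"
    proof (rule prob_space.emeasure_eq_1_AE[OF P_prob[OF P(1)]])
      show "{w \<in> space P. (\<lambda>n. (\<Sum>i<n. Y i w - \<mu> (Suc i)) / a n) \<longlonglongrightarrow> 0} \<in> sets P"
        by measurable
      show "AE w in P. w \<in> {w \<in> space P. (\<lambda>n. (\<Sum>i<n. Y i w - \<mu> (Suc i)) / a n) \<longlonglongrightarrow> 0}"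
        using P(2) AE_space by eventually_elim (simp add: centered_sum_def)
    qed
    then show ?thesis unfolding S Y_def using P(1) by blast
  qed
  show ?thesis using P(1) part1 part2 by blast
qed

end
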